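(* Let $\mu$ be a PW-sampling measure, $t>0$, let $k_t$ be the reproducing kernel at $0$ of $\mathrm{PW}_t(\mu)$, and let $\psi_t=\hat k_t$ be the Fourier transform of $k_t|_{\mathbb R}\in L^2(\mathbb R)$. Then $\psi_t=0$ a.e. on $\mathbb R\setminus[-t,t]$, and the distribution $\psi_t*\hat\mu$ coincides with the constant function $1$ on $(-t,t)$. Moreover $k_t(0)=\frac1{\sqrt{2\pi}}\int_{\mathbb R}\psi_t$.
   Context: Fourier transform convention: $\hat f(\xi)=(2\pi)^{-1/2}\int e^{-i\xi x}f(x)\,dx$, extended to $L^2(\mathbb R)$ and (for the $\Pi$-finite measure $\mu$) to tempered distributions. $\mathrm{PW}_t$: entire functions of exponential type at most $t$ in $L^2(\mathbb R)$, with the $L^2(\mathbb R)$ inner product. $\mu$ (positive measure on $\mathbb R$) is PW-sampling if for every $a>0$ there is $C>0$ with $C^{-1}\|f\|_{L^2(\mathbb R)}\le\|f\|_{L^2(\mu)}\le C\|f\|_{L^2(\mathbb R)}$ for all $f\in\mathrm{PW}_a$; such $\mu$ satisfy $\int d\mu/(1+x^2)<\infty$. $\mathrm{PW}_t(\mu)$ denotes $\mathrm{PW}_t$ with the $L^2(\mu)$ inner product, and $k_t\in\mathrm{PW}_t$ is defined by $f(0)=\int f\bar k_t\,d\mu$ for all $f\in\mathrm{PW}_t$. *)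

theory Defs
  imports "HOL-Analysis.Analysis"
begin

definition fourier_L1 :: "(real \<Rightarrow> complex) \<Rightarrow> real \<Rightarrow> complex" where
  "fourier_L1 g \<xi> = complex_of_real (1 / sqrt (2 * pi)) *
      (LINT x|lborel. exp (- \<i> * complex_of_real (\<xi> * x)) * g x)"

definition square_integrable :: "(real \<Rightarrow> complex) \<Rightarrow> bool" where
  "square_integrable g \<longleftrightarrow> g \<in> borel_measurable lborel \<and> integrable lborel (\<lambda>x. (cmod (g x))\<^sup>2)"

definition is_L2_fourier :: "(real \<Rightarrow> complex) \<Rightarrow> (real \<Rightarrow> complex) \<Rightarrow> bool" where
  "is_L2_fourier g \<psi> \<longleftrightarrow> square_integrable g \<and> square_integrable \<psi> \<and>
     ((\<lambda>R. \<integral>\<^sup>+ \<xi>. ennreal ((cmod (\<psi> \<xi> - complex_of_real (1 / sqrt (2 * pi)) *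
            (LINT x:{-R..R}|lborel. exp (- \<i> * complex_of_real (\<xi> * x)) * g x)))\<^sup>2) \<partial>lborel)
        \<longlongrightarrow> 0) at_top"

definition exp_type_le :: "(complex \<Rightarrow> complex) \<Rightarrow> real \<Rightarrow> bool" where
  "exp_type_le f t \<longleftrightarrow> (\<forall>\<epsilon>>0. \<exists>C. \<forall>z. cmod (f z) \<le> C * exp ((t + \<epsilon>) * cmod z))"

definition PW :: "real \<Rightarrow> (complex \<Rightarrow> complex) set" where
  "PW t = {f. f holomorphic_on UNIV \<and> exp_type_le f t \<and> square_integrable (\<lambda>x. f (complex_of_real x))}"

definition L2_norm_sq :: "real measure \<Rightarrow> (real \<Rightarrow> complex) \<Rightarrow> ennreal" where
  "L2_norm_sq M g = (\<integral>\<^sup>+ x. ennreal ((cmod (g x))\<^sup>2) \<partial>M)"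

text \<open>PW-sampling (stated with squared norms, C^-1 ||f|| <= ||f||_mu <= C ||f||).\<close>
definition PW_sampling :: "real measure \<Rightarrow> bool" where
  "PW_sampling \<mu> \<longleftrightarrow> sets \<mu> = sets borel \<and>
     (\<forall>a>0. \<exists>C>0. \<forall>f\<in>PW a.
        ennreal (1 / C\<^sup>2) * L2_norm_sq lborel (\<lambda>x. f (complex_of_real x)) \<le> L2_norm_sq \<mu> (\<lambda>x. f (complex_of_real x)) \<and>
        L2_norm_sq \<mu> (\<lambda>x. f (complex_of_real x)) \<le> ennreal (C\<^sup>2) * L2_norm_sq lborel (\<lambda>x. f (complex_of_real x)))"

definition reproducing_kernel :: "real measure \<Rightarrow> real \<Rightarrow> (complex \<Rightarrow> complex) \<Rightarrow> bool" where
  "reproducing_kernel \<mu> t k \<longleftrightarrow> k \<in> PW t \<and>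
     (\<forall>f\<in>PW t. f 0 = (LINT x|\<mu>. f (complex_of_real x) * cnj (k (complex_of_real x))))"

definition smooth_fun :: "(real \<Rightarrow> complex) \<Rightarrow> bool" where
  "smooth_fun \<phi> \<longleftrightarrow> (\<exists>D :: nat \<Rightarrow> real \<Rightarrow> complex. D 0 = \<phi> \<and>
      (\<forall>n x. (D n has_vector_derivative D (Suc n) x) (at x)))"

definition tsupp :: "(real \<Rightarrow> complex) \<Rightarrow> real set" where
  "tsupp \<phi> = closure {x. \<phi> x \<noteq> 0}"

definition test_fun_on :: "(real \<Rightarrow> complex) \<Rightarrow> real set \<Rightarrow> bool" where
  "test_fun_on \<phi> U \<longleftrightarrow> smooth_fun \<phi> \<and> compact (tsupp \<phi>) \<and> tsupp \<phi> \<subseteq> U"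

text \<open>Action of the distribution psi * hat mu on a test function phi:
  <psi * hat mu, phi> = <hat mu, psi_check * phi> = integral of (psi_check * phi)^ d mu,
  where psi_check(x) = psi(-x), so (psi_check * phi)(y) = integral psi(x - y) phi(x) dx.\<close>
definition conv_ft_measure_pair :: "(real \<Rightarrow> complex) \<Rightarrow> real measure \<Rightarrow> (real \<Rightarrow> complex) \<Rightarrow> complex" where
  "conv_ft_measure_pair \<psi> \<mu> \<phi> =
     (LINT \<xi>|\<mu>. fourier_L1 (\<lambda>y. LINT x|lborel. \<psi> (x - y) * \<phi> x) \<xi>)"

end

theory Submission
  imports Defs "HOL-Probability.Probability" "HOL-Complex_Analysis.Complex_Analysis"
begin

text \<open>
  The support statement is the Paley--Wiener theorem. Let \<open>f\<close> be entire of exponential type at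
  most \<open>t\<close> and square integrable on the real line, with Taylor coefficients
  \<open>a n / n!\<close>. Its Borel transform
  \<open>B w = (\<Sum>n. a n / w ^ (n + 1))\<close> converges for \<open>|w| > t\<close>, and
  by analytic continuation it equals the Laplace transforms of \<open>f\<close> along both half-lines, up
  to sign. Hence the Abel means
  \<open>\<integral> f x exp (- \<epsilon> |x|) exp (- i \<xi> x) dx = B (\<epsilon> + i \<xi>) - B (- \<epsilon> + i \<xi>)\<close>
  tend to \<open>0\<close> boundedly on compact sets of \<open>|\<xi>| > t\<close>. The multiplication
  formula \<open>\<integral> \<psi> g = \<integral> f (F g)\<close>, with \<open>F\<close> the
  Fourier transform, applied to indicators \<open>g\<close> of intervals outside \<open>[-t, t]\<close>,
  turns this into the vanishing of the \<open>L\<^sup>2\<close> Fourier transform \<open>\<psi>\<close>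
  there. So \<open>\<psi>\<close> is integrable, and the same formula with Gaussian \<open>g\<close> gives
  pointwise Fourier inversion, whose value at \<open>0\<close> is the formula for \<open>k 0\<close>.
  Finally, for a test function \<open>\<phi>\<close> the pairing equals
  \<open>sqrt(2 \<pi>) \<integral> (F \<phi>) k d\<mu>\<close>, and \<open>(F \<phi>)\<close> lies
  in \<open>PW t\<close>, so the reproducing property evaluates it to
  \<open>sqrt(2 \<pi>) (F \<phi>) 0 = \<integral> \<phi>\<close>.
\<close>

subsection \<open>Square integrability and the multiplication formula\<close>

lemma tendsto_integral_symmetric_intervals:
  fixes f :: "real \<Rightarrow> 'a :: {banach, second_countable_topology}"
  assumes f: "integrable lborel f"
  shows "(\<lambda>n. LINT x:{- real n..real n}|lborel. f x) \<longlonglongrightarrow> (LINT x|lborel. f x)"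
  unfolding set_lebesgue_integral_def
proof (rule integral_dominated_convergence[where w = "\<lambda>x. norm (f x)"])
  have [measurable]: "f \<in> borel_measurable borel" using f by auto
  show "AE x in lborel. (\<lambda>n. indicator {- real n..real n} x *\<^sub>R f x) \<longlonglongrightarrow> f x"
  proof (intro AE_I2 tendsto_eventually)
    fix x :: real
    obtain N :: nat where N: "\<bar>x\<bar> \<le> real N" using real_arch_simple by blast
    show "\<forall>\<^sub>F n in sequentially. indicator {- real n..real n} x *\<^sub>R f x = f x"
      using eventually_ge_at_top[of N]
    proof eventually_elim
      case (elim n)
      then have "x \<in> {- real n..real n}" using N by auto
      then show ?case by simp
    qed
  qed
  show "(\<lambda>x. indicator {- real n..real n} x *\<^sub>R f x) \<in> borel_measurable lborel" for n
    by measurable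
qed (use f in \<open>auto split: split_indicator\<close>)

text \<open>Compact intervals form an intersection-stable generator of the Borel sets, so Dynkin's
  theorem extends the vanishing from intervals to all Borel sets, and the density of the zero
  measure is null.\<close>

lemma AE_zero_if_interval_integrals_zero:
  fixes f :: "real \<Rightarrow> 'a :: {banach, second_countable_topology}"
  assumes f: "integrable lborel f"
    and zero: "\<And>a b. (LINT x:{a..b}|lborel. f x) = 0"
  shows "AE x in lborel. f x = 0"
proof (rule sigma_finite_measure.density_zero[OF sigma_finite_lborel f])
  have [measurable]: "f \<in> borel_measurable borel" using f by auto
  have int_ind: "integrable lborel (\<lambda>x. indicator A x *\<^sub>R f x)" if "A \<in> sets borel" for A
    using that f by (intro integrable_mult_indicator) auto
  \<comment> \<open>The complement step needs the integral over the whole line. The line is not a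
    compact interval, so its integral is reached as a limit.\<close>
  have "(\<lambda>n. LINT x:{- real n..real n}|lborel. f x) \<longlonglongrightarrow> (LINT x|lborel. f x)"
    by (rule tendsto_integral_symmetric_intervals[OF f])
  then have total: "(LINT x|lborel. f x) = 0"
    by (simp add: zero LIMSEQ_const_iff)
  have stable: "Int_stable (range (\<lambda>(a, b). {a..b::real}))"
    by (auto simp: Int_stable_def image_iff)
  have sub: "range (\<lambda>(a, b). {a..b::real}) \<subseteq> Pow UNIV" by simp
  fix A :: "real set" assume "A \<in> sets lborel"
  then have "A \<in> sigma_sets UNIV (range (\<lambda>(a, b). {a..b::real}))"
    by (simp add: borel_eq_atLeastAtMost)
  from stable sub this show "(LINT x:A|lborel. f x) = 0"
  proof (induction rule: sigma_sets_induct_disjoint)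
    case (compl A)
    then have [measurable]: "A \<in> sets borel" by (simp add: borel_eq_atLeastAtMost)
    have "(LINT x:UNIV - A|lborel. f x) = (LINT x|lborel. f x) - (LINT x:A|lborel. f x)"
      unfolding set_lebesgue_integral_def
      by (subst Bochner_Integration.integral_diff[symmetric])
         (auto intro!: Bochner_Integration.integral_cong f int_ind split: split_indicator)
    then show ?case by (simp add: total compl)
  next
    case (union A)
    then have A: "A i \<in> sets borel" for i by (auto simp: borel_eq_atLeastAtMost)
    have "(LINT x:(\<Union>i. A i)|lborel. f x) = (\<Sum>i. LINT x:A i|lborel. f x)"
      by (rule lebesgue_integral_countable_add)
         (use A union int_ind in \<open>auto simp: set_integrable_def disjoint_family_on_def\<close>)
    then show ?case by (simp add: union)
  qed (auto simp: zero set_lebesgue_integral_def[of _ "{}"])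
qed

section \<open>Square integrable functions and limits of their pairings\<close>

lemma square_integrable_integrable_mult:
  fixes f g :: "real \<Rightarrow> complex"
  assumes "square_integrable f" "square_integrable g"
  shows "integrable lborel (\<lambda>x. f x * g x)"
proof (rule Bochner_Integration.integrable_bound[where f = "\<lambda>x. (cmod (f x))\<^sup>2 + (cmod (g x))\<^sup>2"])
  have "a * b \<le> a\<^sup>2 + b\<^sup>2" if "a \<ge> 0" "b \<ge> 0" for a b :: real
  proof -
    have "0 \<le> (a - b)\<^sup>2" "0 \<le> a * b" using that by auto
    then show ?thesis by (simp add: power2_eq_square algebra_simps)
  qed
  then show "AE x in lborel. norm (f x * g x) \<le> norm ((cmod (f x))\<^sup>2 + (cmod (g x))\<^sup>2)"
    by (intro AE_I2) (simp add: norm_mult)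
qed (use assms in \<open>auto simp: square_integrable_def\<close>)

lemma square_integrable_indicator:
  "square_integrable (\<lambda>x. indicator {a..b} x *\<^sub>R 1)"
proof -
  have "(\<lambda>x. (cmod (indicator {a..b} x *\<^sub>R 1))\<^sup>2) = indicator {a..b::real}"
    by (auto split: split_indicator)
  moreover have "integrable lborel (indicator {a..b::real} :: real \<Rightarrow> real)"
    by (intro integrable_real_indicator emeasure_lborel_Icc_eq[THEN ord_eq_less_trans]) auto
  ultimately show ?thesis
    by (simp add: square_integrable_def)
qed

lemma square_integrable_integrable_on_interval:
  assumes "square_integrable f"
  shows "integrable lborel (\<lambda>x. indicator {a..b} x *\<^sub>R f x)"
  using square_integrable_integrable_mult[OF square_integrable_indicator assms]
  by (simp add: scaleR_conv_of_real)

lemma fourier_L1_measurable [measurable]: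
  assumes [measurable]: "g \<in> borel_measurable borel"
  shows "fourier_L1 g \<in> borel_measurable borel"
  unfolding fourier_L1_def[abs_def] by measurable

text \<open>Cauchy-Schwarz bounds the squared error by the squared distance of \<open>h n\<close> to
  \<psi> times the squared norm of \<open>g\<close>. The estimate runs in \<open>ennreal\<close>
  because the distance is a nonnegative integral that may be infinite for individual
  \<open>n\<close>.\<close>

lemma tendsto_integral_mult_L2:
  fixes g \<psi> :: "real \<Rightarrow> complex" and h :: "nat \<Rightarrow> real \<Rightarrow> complex"
  assumes g: "square_integrable g"
    and [measurable]: "\<psi> \<in> borel_measurable borel" "\<And>n. h n \<in> borel_measurable borel"
    and h: "\<And>n. integrable lborel (\<lambda>x. h n x * g x)"
    and \<psi>: "integrable lborel (\<lambda>x. \<psi> x * g x)"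
    and lim: "(\<lambda>n. \<integral>\<^sup>+ x. ennreal ((cmod (\<psi> x - h n x))\<^sup>2) \<partial>lborel) \<longlonglongrightarrow> 0"
  shows "(\<lambda>n. LINT x|lborel. h n x * g x) \<longlonglongrightarrow> (LINT x|lborel. \<psi> x * g x)"
proof -
  have [measurable]: "g \<in> borel_measurable borel" and g2: "integrable lborel (\<lambda>x. (cmod (g x))\<^sup>2)"
    using g by (auto simp: square_integrable_def)
  define A where "A n = (\<integral>\<^sup>+ x. ennreal ((cmod (\<psi> x - h n x))\<^sup>2) \<partial>lborel)" for n
  define B where "B = (\<integral>\<^sup>+ x. ennreal ((cmod (g x))\<^sup>2) \<partial>lborel)"
  have B: "B < \<top>"
    unfolding B_def using g2 by (simp add: nn_integral_eq_integral)
  have le: "ennreal ((cmod ((LINT x|lborel. \<psi> x * g x) - (LINT x|lborel. h n x * g x)))\<^sup>2) \<le> A n * B" for n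
  proof -
    have "(LINT x|lborel. \<psi> x * g x) - (LINT x|lborel. h n x * g x) = (LINT x|lborel. (\<psi> x - h n x) * g x)"
      using \<psi> h by (simp add: algebra_simps)
    also have "ennreal (cmod \<dots>) \<le> (\<integral>\<^sup>+ x. ennreal (cmod ((\<psi> x - h n x) * g x)) \<partial>lborel)"
      using \<psi> h by (intro integral_norm_bound_ennreal) (simp add: algebra_simps)
    also have "\<dots> = (\<integral>\<^sup>+ x. ennreal (cmod (\<psi> x - h n x)) * ennreal (cmod (g x)) \<partial>lborel)"
      by (simp add: norm_mult ennreal_mult)
    finally have "(ennreal (cmod ((LINT x|lborel. \<psi> x * g x) - (LINT x|lborel. h n x * g x))))\<^sup>2
        \<le> (\<integral>\<^sup>+ x. ennreal (cmod (\<psi> x - h n x)) * ennreal (cmod (g x)) \<partial>lborel)\<^sup>2"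
      by (rule power_mono) simp
    also have "\<dots> \<le> A n * B"
      unfolding A_def B_def by (rule order_trans[OF Cauchy_Schwarz_nn_integral]) (simp_all add: ennreal_power)
    finally show ?thesis by (simp add: ennreal_power)
  qed
  define d where "d n = (LINT x|lborel. \<psi> x * g x) - (LINT x|lborel. h n x * g x)" for n
  \<comment> \<open>Finiteness of \<open>B\<close> rules out the indeterminate product of zero and
    infinity.\<close>
  have "(\<lambda>n. A n * B) \<longlonglongrightarrow> 0 * B"
    using lim B by (intro tendsto_mult_ennreal) (auto simp: A_def)
  then have lim0: "(\<lambda>n. A n * B) \<longlonglongrightarrow> ennreal 0" by simp
  have "(\<lambda>n. ennreal ((cmod (d n))\<^sup>2)) \<longlonglongrightarrow> ennreal 0"
    by (rule tendsto_sandwich[OF _ _ tendsto_const lim0]) (simp_all add: le d_def)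
  then have "(\<lambda>n. (cmod (d n))\<^sup>2) \<longlonglongrightarrow> 0"
    by (subst (asm) tendsto_ennreal_iff) auto
  then have "(\<lambda>n. cmod (d n)) \<longlonglongrightarrow> 0"
    using tendsto_real_sqrt[of "\<lambda>n. (cmod (d n))\<^sup>2" 0] by simp
  then have "d \<longlonglongrightarrow> 0"
    by (rule tendsto_norm_zero_cancel)
  from tendsto_diff[OF tendsto_const[of "LINT x|lborel. \<psi> x * g x"] this] show ?thesis
    by (simp add: d_def)
qed

text \<open>Fubini: the exponential kernel has modulus 1 and is symmetric in the two
  variables.\<close>

lemma fourier_L1_multiplication_formula:
  assumes f: "integrable lborel f" and g: "integrable lborel g"
  shows "integrable lborel (\<lambda>u. fourier_L1 f u * g u)"
    and "(LINT u|lborel. fourier_L1 f u * g u) = (LINT x|lborel. f x * fourier_L1 g x)"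
proof -
  define c where "c = complex_of_real (1 / sqrt (2 * pi))"
  have [measurable]: "f \<in> borel_measurable borel" "g \<in> borel_measurable borel"
    using f g by auto
  have prod: "integrable (lborel \<Otimes>\<^sub>M lborel) (\<lambda>(u, x). exp (- \<i> * complex_of_real (u * x)) * f x * g u)"
  proof (rule lborel_pair.Fubini_integrable)
    show "integrable lborel (\<lambda>u. LINT x|lborel. norm (case (u, x) of (u, x) \<Rightarrow>
        exp (- \<i> * complex_of_real (u * x)) * f x * g u))"
      using g by (simp add: norm_mult)
    show "AE u in lborel. integrable lborel (\<lambda>x. case (u, x) of (u, x) \<Rightarrow>
        exp (- \<i> * complex_of_real (u * x)) * f x * g u)"
    proof (intro AE_I2)
      fix u
      have "integrable lborel (\<lambda>x. exp (- \<i> * complex_of_real (u * x)) * f x)"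
        by (rule Bochner_Integration.integrable_bound[OF f]) (auto simp: norm_mult)
      then show "integrable lborel (\<lambda>x. case (u, x) of (u, x) \<Rightarrow>
        exp (- \<i> * complex_of_real (u * x)) * f x * g u)"
        by simp
    qed
  qed measurable
  have eq: "fourier_L1 f u * g u = c * (LINT x|lborel. exp (- \<i> * complex_of_real (u * x)) * f x * g u)" for u
    by (simp add: fourier_L1_def c_def)
  show "integrable lborel (\<lambda>u. fourier_L1 f u * g u)"
    unfolding eq using lborel_pair.integrable_fst'[OF prod] by simp
  have "(LINT u|lborel. fourier_L1 f u * g u) = c * (LINT u|lborel. LINT x|lborel. exp (- \<i> * complex_of_real (u * x)) * f x * g u)"
    unfolding eq by simp
  also have "\<dots> = c * (LINT x|lborel. LINT u|lborel. exp (- \<i> * complex_of_real (u * x)) * f x * g u)"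
    using lborel_pair.Fubini_integral[OF prod] by simp
  also have "\<dots> = (LINT x|lborel. c * (LINT u|lborel. f x * (exp (- \<i> * complex_of_real (x * u)) * g u)))"
    by (simp add: mult_ac)
  also have "\<dots> = (LINT x|lborel. f x * fourier_L1 g x)"
    unfolding fourier_L1_def c_def by (intro Bochner_Integration.integral_cong) simp_all
  finally show "(LINT u|lborel. fourier_L1 f u * g u) = (LINT x|lborel. f x * fourier_L1 g x)" .
qed

text \<open>The truncations of \<open>f\<close> to \<open>[-n, n]\<close> are integrable, so the
  classical formula holds for them. The left sides converge because the truncated transforms tend to
  \<psi> in mean square, the right sides because \<open>f\<close> times \<open>fourier_L1 g\<close>
  is integrable. Plancherel is bypassed: square integrability of \<open>fourier_L1 g\<close> is
  assumed here and checked by hand for interval indicators and Gaussians.\<close>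

lemma L2_fourier_multiplication_formula:
  assumes F: "is_L2_fourier f \<psi>"
    and g1: "integrable lborel g" and g2: "square_integrable g"
    and gh: "square_integrable (fourier_L1 g)"
  shows "(LINT u|lborel. \<psi> u * g u) = (LINT x|lborel. f x * fourier_L1 g x)"
proof -
  define h where "h n = fourier_L1 (\<lambda>x. indicator {- real n..real n} x *\<^sub>R f x)" for n
  have f2: "square_integrable f" and \<psi>2: "square_integrable \<psi>"
    using F by (auto simp: is_L2_fourier_def)
  have [measurable]: "f \<in> borel_measurable borel" "\<psi> \<in> borel_measurable borel" "g \<in> borel_measurable borel"
    using f2 \<psi>2 g2 by (auto simp: square_integrable_def)
  have hm [measurable]: "h n \<in> borel_measurable borel" for n
    unfolding h_def by measurable
  have fint: "integrable lborel (\<lambda>x. indicator {- real n..real n} x *\<^sub>R f x)" for n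
    by (rule square_integrable_integrable_on_interval[OF f2])
  have "((\<lambda>R. \<integral>\<^sup>+ \<xi>. ennreal ((cmod (\<psi> \<xi> - complex_of_real (1 / sqrt (2 * pi)) * (LINT x:{-R..R}|lborel.
      exp (- \<i> * complex_of_real (\<xi> * x)) * f x)))\<^sup>2) \<partial>lborel) \<longlongrightarrow> 0) at_top"
    using F unfolding is_L2_fourier_def by blast
  from filterlim_compose[OF this filterlim_real_sequentially]
  have "(\<lambda>n. \<integral>\<^sup>+ u. ennreal ((cmod (\<psi> u - h n u))\<^sup>2) \<partial>lborel) \<longlonglongrightarrow> 0"
    by (simp add: h_def fourier_L1_def set_lebesgue_integral_def)
  then have "(\<lambda>n. LINT u|lborel. h n u * g u) \<longlonglongrightarrow> (LINT u|lborel. \<psi> u * g u)"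
    by (intro tendsto_integral_mult_L2 g2 fourier_L1_multiplication_formula(1)[OF fint g1, folded h_def]
        square_integrable_integrable_mult \<psi>2) auto
  moreover have "(LINT u|lborel. h n u * g u) = (LINT x:{- real n..real n}|lborel. f x * fourier_L1 g x)" for n
    unfolding h_def fourier_L1_multiplication_formula(2)[OF fint g1] by (simp add: set_lebesgue_integral_def)
  ultimately show ?thesis
    using LIMSEQ_unique tendsto_integral_symmetric_intervals[OF square_integrable_integrable_mult[OF f2 gh]]
    by auto
qed

subsection \<open>Borel and Laplace transforms\<close>

definition laplace_transform :: "(real \<Rightarrow> complex) \<Rightarrow> complex \<Rightarrow> complex" where
  "laplace_transform g w = (LINT x:{0..}|lborel. exp (- w * complex_of_real x) * g x)"

definition borel_transform :: "(nat \<Rightarrow> complex) \<Rightarrow> complex \<Rightarrow> complex" where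
  "borel_transform a w = (\<Sum>n. a n / w ^ Suc n)"

text \<open>The Gamma integral, rescaled from \<open>s = 1\<close>. It gives the Laplace transform
  of a Taylor monomial and also serves to integrate Cauchy's estimate over the radius.\<close>

lemma has_bochner_integral_power_exp:
  fixes s :: real
  assumes "s > 0"
  shows "has_bochner_integral lborel (\<lambda>x. indicator {0..} x *\<^sub>R (x ^ n * exp (- s * x))) (fact n / s ^ Suc n)"
proof -
  have "has_bochner_integral lborel
      (\<lambda>x. (0 + s * x) ^ n * exp (- (0 + s * x)) * indicator {0..} (0 + s * x)) (fact n /\<^sub>R \<bar>s\<bar>)"
    using lborel_has_bochner_integral_real_affine_iff[THEN iffD1, OF _ has_bochner_integral_I0i_power_exp_m', of s 0 n] assms
    by simp
  from has_bochner_integral_mult_right[OF this, of "1 / s ^ n"]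
  have "has_bochner_integral lborel
      (\<lambda>x. (1 / s ^ n) * ((0 + s * x) ^ n * exp (- (0 + s * x)) * indicator {0..} (0 + s * x))) ((1 / s ^ n) * (fact n /\<^sub>R \<bar>s\<bar>))"
    by simp
  then show ?thesis
  proof (rule has_bochner_integral_cong[THEN iffD1, rotated -1])
    show "(1 / s ^ n) * (fact n /\<^sub>R \<bar>s\<bar>) = fact n / s ^ Suc n"
      using assms by (simp add: field_simps)
    show "(1 / s ^ n) * ((0 + s * x) ^ n * exp (- (0 + s * x)) * indicator {0..} (0 + s * x))
        = indicator {0..} x *\<^sub>R (x ^ n * exp (- s * x))" for x
      using assms by (auto simp: indicator_def zero_le_mult_iff power_mult_distrib)
  qed simp
qed

text \<open>Integrating Cauchy's estimate \<open>|a| r ^ n \<le> n! C exp (S r)\<close> against \<open>exp (- T r)\<close>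
  avoids optimising over the radius.\<close>

lemma deriv_bound_exp_type:
  assumes hol: "f holomorphic_on UNIV" and bound: "\<And>z. cmod (f z) \<le> C * exp (S * cmod z)"
    and "0 < T" "S < T"
  shows "cmod ((deriv ^^ n) f 0) \<le> C / (T - S) * T ^ Suc n"
proof -
  let ?a = "cmod ((deriv ^^ n) f 0)"
  have a: "?a * r ^ n \<le> fact n * C * exp (S * r)" if "r > 0" for r
  proof -
    have "?a \<le> fact n * (C * exp (S * r)) / r ^ n"
      by (rule Cauchy_inequality)
         (use that bound hol in \<open>auto intro: holomorphic_on_subset holomorphic_on_imp_continuous_on\<close>)
    then show ?thesis using that by (simp add: field_simps)
  qed
  have i1: "has_bochner_integral lborel (\<lambda>x. ?a * (indicator {0..} x *\<^sub>R (x ^ n * exp (- T * x)))) (?a * (fact n / T ^ Suc n))"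
    by (rule has_bochner_integral_mult_right) (use has_bochner_integral_power_exp[of T n] \<open>0 < T\<close> in auto)
  have i2: "has_bochner_integral lborel (\<lambda>x. (fact n * C) * (indicator {0..} x *\<^sub>R (x ^ 0 * exp (- (T - S) * x)))) ((fact n * C) * (fact 0 / (T - S) ^ Suc 0))"
    by (rule has_bochner_integral_mult_right) (use has_bochner_integral_power_exp[of "T - S" 0] \<open>S < T\<close> in auto)
  have "?a * (fact n / T ^ Suc n) \<le> (fact n * C) * (fact 0 / (T - S) ^ Suc 0)"
  proof -
    have "(LINT x|lborel. ?a * (indicator {0..} x *\<^sub>R (x ^ n * exp (- T * x))))
        \<le> (LINT x|lborel. (fact n * C) * (indicator {0..} x *\<^sub>R (x ^ 0 * exp (- (T - S) * x))))"
    proof (rule integral_mono_AE)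
      show "AE x in lborel. ?a * (indicator {0..} x *\<^sub>R (x ^ n * exp (- T * x)))
          \<le> (fact n * C) * (indicator {0..} x *\<^sub>R (x ^ 0 * exp (- (T - S) * x)))"
        \<comment> \<open>The estimate \<open>a\<close> is available for positive radii only, so the
          point 0 is discarded as a null set.\<close>
        using AE_lborel_singleton[of "0::real"]
      proof eventually_elim
        case (elim x)
        show ?case
        proof (cases "x > 0")
          case True
          have "?a * x ^ n * exp (- T * x) \<le> fact n * C * exp (S * x) * exp (- T * x)"
            by (rule mult_right_mono[OF a[OF True]]) simp
          also have "\<dots> = fact n * C * exp (- (T - S) * x)"
            by (simp add: algebra_simps flip: exp_add)
          finally show ?thesis using True by (simp add: mult_ac)
        qed (use elim in auto)
      qed
    qed (use i1 i2 in \<open>auto simp: has_bochner_integral_iff\<close>)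
    with i1 i2 show ?thesis by (simp only: has_bochner_integral_iff)
  qed
  then have "fact n * (?a / T ^ Suc n) \<le> fact n * (C / (T - S))" by (simp add: mult.commute)
  then have "?a / T ^ Suc n \<le> C / (T - S)" by (simp only: mult_le_cancel_left_pos fact_gt_zero)
  then show ?thesis using \<open>0 < T\<close> by (subst (asm) pos_divide_le_eq) auto
qed

section \<open>The Borel transform outside a disc\<close>

lemma borel_transform_term_bound:
  assumes "\<And>n. cmod (a n) \<le> K * T ^ n" "0 < T" "T < r" "r \<le> cmod w"
  shows "cmod (a n / w ^ Suc n) \<le> K / r * (T / r) ^ n"
proof -
  have K: "0 \<le> K" using order_trans[OF norm_ge_zero assms(1)[of 0]] by simp
  have "cmod (a n / w ^ Suc n) = cmod (a n) / cmod w ^ Suc n"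
    by (simp add: norm_divide norm_power norm_mult)
  also have "\<dots> \<le> (K * T ^ n) / r ^ Suc n"
    using assms K by (intro frac_le power_mono) auto
  also have "\<dots> = K / r * (T / r) ^ n" by (simp add: power_divide)
  finally show ?thesis .
qed

lemma borel_transform_sums:
  assumes "\<And>n. cmod (a n) \<le> K * T ^ n" "0 < T" "T < cmod w"
  shows "(\<lambda>n. a n / w ^ Suc n) sums borel_transform a w"
  unfolding borel_transform_def
proof (rule summable_sums, rule summable_comparison_test')
  show "summable (\<lambda>n. K / cmod w * (T / cmod w) ^ n)"
    using assms by (intro summable_mult summable_geometric) (auto simp: divide_less_eq)
  show "norm (a n / w ^ Suc n) \<le> K / cmod w * (T / cmod w) ^ n" if "n \<ge> 0" for n
    using assms by (intro borel_transform_term_bound) auto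
qed

text \<open>Sum of the geometric majorant. Being uniform on \<open>|w| >= r\<close>, it provides the
  dominating constant when the Abel parameter tends to 0.\<close>

lemma borel_transform_bound:
  assumes a: "\<And>n. cmod (a n) \<le> K * T ^ n" "0 < T" "T < r" "r \<le> cmod w"
  shows "cmod (borel_transform a w) \<le> K / (r - T)"
proof -
  have s: "(\<lambda>n. K / r * (T / r) ^ n) sums (K / r * (1 / (1 - T / r)))"
    using assms by (intro sums_mult geometric_sums) auto
  have "cmod (borel_transform a w) \<le> (\<Sum>n. K / r * (T / r) ^ n)"
    unfolding borel_transform_def
    by (rule norm_suminf_le[OF _ sums_summable[OF s]]) (rule borel_transform_term_bound[OF assms])
  also have "\<dots> = K / r * (1 / (1 - T / r))" using s by (simp add: sums_iff)
  also have "\<dots> = K / (r - T)" using assms by (simp add: field_simps)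
  finally show ?thesis .
qed

text \<open>In the variable \<open>v = 1 / w\<close> the series is \<open>v\<close> times the power
  series \<open>p v\<close>, which converges for \<open>|v| < 1 / T\<close>.\<close>

lemma borel_transform_holomorphic:
  assumes a: "\<And>n. cmod (a n) \<le> K * T ^ n" "0 < T"
  shows "borel_transform a holomorphic_on {w. T < cmod w}"
proof -
  define p where "p v = (\<Sum>n. a n * v ^ n)" for v
  have "p holomorphic_on ball 0 (1 / T)"
  proof (rule power_series_holomorphic)
    fix v assume "v \<in> ball (0::complex) (1 / T)"
    then have v: "cmod v * T < 1" using a by (simp add: field_simps)
    have "summable (\<lambda>n. a n * v ^ n)"
    proof (rule summable_comparison_test')
      show "summable (\<lambda>n. K * (T * cmod v) ^ n)"
        using v a by (intro summable_mult summable_geometric) (auto simp: abs_mult mult.commute)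
      show "norm (a n * v ^ n) \<le> K * (T * cmod v) ^ n" for n
        using mult_right_mono[OF a(1)[of n], of "cmod v ^ n"]
        by (simp add: norm_mult norm_power power_mult_distrib mult_ac)
    qed
    then show "(\<lambda>n. a n * (v - 0) ^ n) sums p v" by (simp add: p_def summable_sums)
  qed
  then have "(p \<circ> (\<lambda>w. 1 / w)) holomorphic_on {w. T < cmod w}"
    by (rule holomorphic_on_compose_gen[rotated])
       (use a in \<open>auto intro!: holomorphic_intros simp: norm_divide intro!: divide_strict_left_mono mult_pos_pos\<close>)
  then have "(\<lambda>w. (1 / w) * p (1 / w)) holomorphic_on {w. T < cmod w}"
    using a by (intro holomorphic_on_mult) (auto intro!: holomorphic_intros simp: o_def)
  moreover have "(1 / w) * p (1 / w) = borel_transform a w" if "w \<in> {w. T < cmod w}" for w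
  proof -
    have "w \<noteq> 0" using that a by auto
    then have "(\<lambda>n. w * (a n / w ^ Suc n)) sums (w * borel_transform a w)"
      by (intro sums_mult borel_transform_sums[OF a]) (use that in auto)
    then have "p (1 / w) = w * borel_transform a w"
      using \<open>w \<noteq> 0\<close> by (simp add: p_def sums_iff power_one_over field_simps)
    then show ?thesis using \<open>w \<noteq> 0\<close> by simp
  qed
  ultimately show ?thesis by (rule holomorphic_transform)
qed

text \<open>The Taylor series is integrated term by term. This is legitimate for
  \<open>s > T\<close>, since the integrals of the absolute values of the terms are
  \<open>cmod (a n) / s ^ Suc n\<close>, dominated by a geometric series of ratio
  \<open>T / s\<close>.\<close>

lemma laplace_transform_eq_borel_transform_real:
  fixes s :: real
  assumes a: "\<And>n. cmod (a n) \<le> K * T ^ n" "0 < T" "T < s"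
    and g: "\<And>x. (\<lambda>n. a n / fact n * complex_of_real x ^ n) sums g x"
  shows "laplace_transform g s = borel_transform a s"
proof -
  have K: "0 \<le> K" using order_trans[OF norm_ge_zero a(1)[of 0]] by simp
  define r where "r n x = indicator {0..} x *\<^sub>R (x ^ n * exp (- s * x))" for n x
  define F where "F n x = (a n / fact n) * complex_of_real (r n x)" for n x
  have r: "has_bochner_integral lborel (r n) (fact n / s ^ Suc n)" for n
    using has_bochner_integral_power_exp[of s n] a unfolding r_def by simp
  have rpos: "r n x \<ge> 0" for n x by (simp add: r_def indicator_def)
  have F: "has_bochner_integral lborel (F n) (a n / s ^ Suc n)" for n
  proof -
    have "has_bochner_integral lborel (F n) ((a n / fact n) * complex_of_real (fact n / s ^ Suc n))"
      unfolding F_def by (intro has_bochner_integral_mult_right has_bochner_integral_of_real r)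
    then show ?thesis by simp
  qed
  have norm_F: "norm (F n x) = cmod (a n) / fact n * r n x" for n x
    using rpos[of n x] by (simp add: F_def norm_mult norm_divide)
  have sumF: "(\<lambda>n. F n x) sums (indicator {0..} x *\<^sub>R (exp (- s * complex_of_real x) * g x))" for x
  proof -
    have "(\<lambda>n. complex_of_real (indicator {0..} x * exp (- s * x)) * (a n / fact n * complex_of_real x ^ n))
        sums (complex_of_real (indicator {0..} x * exp (- s * x)) * g x)"
      by (rule sums_mult[OF g])
    then show ?thesis
      by (simp add: F_def r_def scaleR_conv_of_real mult_ac exp_of_real[symmetric])
  qed
  have "(\<lambda>n. integral\<^sup>L lborel (F n)) sums (LINT x|lborel. (\<Sum>n. F n x))"
  proof (rule sums_integral)
    show "integrable lborel (F n)" for n using F by (auto simp: has_bochner_integral_iff)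
    have "(LINT x|lborel. norm (F n x)) = cmod (a n / s ^ Suc n)" for n
    proof -
      have "(LINT x|lborel. norm (F n x)) = cmod (a n) / fact n * (fact n / s ^ Suc n)"
        unfolding norm_F using r[of n] by (simp add: has_bochner_integral_iff)
      also have "\<dots> = cmod (a n / s ^ Suc n)"
        using a by (simp add: norm_divide norm_power norm_mult)
      finally show ?thesis .
    qed
    moreover have "summable (\<lambda>n. cmod (a n / s ^ Suc n))"
    proof (rule summable_comparison_test')
      show "summable (\<lambda>n. K / s * (T / s) ^ n)"
        using a by (intro summable_mult summable_geometric) auto
      show "norm (cmod (a n / s ^ Suc n)) \<le> K / s * (T / s) ^ n" for n
        using borel_transform_term_bound[of a K T s s n] a by simp
    qed
    ultimately show "summable (\<lambda>n. LINT x|lborel. norm (F n x))" by simp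
    \<comment> \<open>Dropping the factor \<open>exp (- s * x)\<close>, at most 1 on the half-line,
      leaves \<open>K\<close> times the exponential series of
      \<open>T * \<bar>x\<bar>\<close>.\<close>
    show "AE x in lborel. summable (\<lambda>n. norm (F n x))"
    proof (rule AE_I2, rule summable_comparison_test')
      fix x :: real
      show "summable (\<lambda>n. K * (inverse (fact n) * (T * \<bar>x\<bar>) ^ n))"
        by (intro summable_mult summable_exp)
      fix n
      have "norm (norm (F n x)) = cmod (a n) * (r n x / fact n)"
        using rpos[of n x] by (simp add: norm_F abs_mult)
      also have "\<dots> \<le> (K * T ^ n) * (\<bar>x\<bar> ^ n / fact n)"
      proof (intro mult_mono a divide_right_mono)
        show "r n x \<le> \<bar>x\<bar> ^ n"
          using a by (auto simp: r_def indicator_def mult_left_le)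
      qed (use rpos a K in auto)
      finally show "norm (norm (F n x)) \<le> K * (inverse (fact n) * (T * \<bar>x\<bar>) ^ n)"
        by (simp add: power_mult_distrib field_simps)
    qed
  qed
  moreover have "(LINT x|lborel. (\<Sum>n. F n x)) = laplace_transform g s"
    using sumF by (simp add: laplace_transform_def set_lebesgue_integral_def sums_iff)
  moreover have "integral\<^sup>L lborel (F n) = a n / s ^ Suc n" for n
    using F by (simp add: has_bochner_integral_iff)
  ultimately have "(\<lambda>n. a n / complex_of_real s ^ Suc n) sums laplace_transform g s" by simp
  then show ?thesis by (simp add: borel_transform_def sums_iff)
qed

section \<open>Laplace transforms on the right half-plane and their continuation\<close>

lemma square_integrable_exp_Ici:
  fixes c :: real
  assumes "c > 0"
  shows "square_integrable (\<lambda>x. complex_of_real (indicator {0..} x * exp (- c * x)))"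
  unfolding square_integrable_def
proof
  have "integrable lborel (\<lambda>x. indicator {0..} x *\<^sub>R (x ^ 0 * exp (- (2 * c) * x)))"
    using has_bochner_integral_power_exp[of "2 * c" 0] assms by (auto simp: has_bochner_integral_iff)
  also have "(\<lambda>x. indicator {0..} x *\<^sub>R (x ^ 0 * exp (- (2 * c) * x)))
      = (\<lambda>x. (cmod (complex_of_real (indicator {0..} x * exp (- c * x))))\<^sup>2)"
    by (auto simp: indicator_def power2_eq_square simp flip: exp_add)
  finally show "integrable lborel (\<lambda>x. (cmod (complex_of_real (indicator {0..} x * exp (- c * x))))\<^sup>2)" .
qed measurable

text \<open>The exponential weight is square integrable on the half-line, and so is
  \<open>g\<close>. This gives convergence on the whole right half-plane, whereas growth of rate
  \<open>T\<close> alone would give only \<open>Re w > T\<close>.\<close>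

lemma integrable_laplace:
  assumes g: "square_integrable g" and w: "0 < Re w"
  shows "integrable lborel (\<lambda>x. indicator {0..} x *\<^sub>R (exp (- w * complex_of_real x) * g x))"
proof (rule Bochner_Integration.integrable_bound)
  have [measurable]: "g \<in> borel_measurable borel" using g by (auto simp: square_integrable_def)
  show "integrable lborel (\<lambda>x. complex_of_real (indicator {0..} x * exp (- Re w * x)) * g x)"
    by (rule square_integrable_integrable_mult[OF square_integrable_exp_Ici[OF w] g])
  show "(\<lambda>x. indicator {0..} x *\<^sub>R (exp (- w * complex_of_real x) * g x)) \<in> borel_measurable lborel"
    by measurable
  show "AE x in lborel. norm (indicator {0..} x *\<^sub>R (exp (- w * complex_of_real x) * g x))
      \<le> norm (complex_of_real (indicator {0..} x * exp (- Re w * x)) * g x)"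
    by (simp add: norm_mult)
qed

text \<open>The integrals over \<open>[0, n]\<close> are holomorphic by differentiation under the
  integral sign, and they converge uniformly on small closed discs because one integrable function
  bounds all the tails.\<close>

lemma laplace_transform_holomorphic:
  assumes g: "square_integrable g" and cont: "continuous_on UNIV g"
  shows "laplace_transform g holomorphic_on {w. 0 < Re w}"
proof (rule holomorphic_uniform_sequence)
  \<comment> \<open>The half-line indicator inside a symmetric interval leaves the integral over
    \<open>[0, n]\<close>, in a form to which \<open>tendsto_integral_symmetric_intervals\<close> is
    adapted.\<close>
  define L where "L n w = (LINT x:{- real n..real n}|lborel. indicator {0..} x *\<^sub>R (exp (- w * complex_of_real x) * g x))" for n w
  have [measurable]: "g \<in> borel_measurable borel" using g by (auto simp: square_integrable_def)
  show "open {w. 0 < Re w}" by (rule open_halfspace_Re_gt)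
  have contg: "continuous_on A g" for A using cont continuous_on_subset by blast
  show "L n holomorphic_on {w. 0 < Re w}" for n
  proof -
    have "(\<lambda>w. integral (cbox 0 (real n)) (\<lambda>x. exp (- w * complex_of_real x) * g x)) holomorphic_on {w. 0 < Re w}"
    proof (rule leibniz_rule_holomorphic)
      show "((\<lambda>w. exp (- w * complex_of_real x) * g x) has_field_derivative
          (- complex_of_real x * exp (- w * complex_of_real x)) * g x) (at w within {w. 0 < Re w})" for w x
        by (auto intro!: derivative_eq_intros)
      show "(\<lambda>x. exp (- w * complex_of_real x) * g x) integrable_on cbox 0 (real n)" for w
        by (intro integrable_continuous continuous_intros contg)
      show "continuous_on ({w. 0 < Re w} \<times> cbox 0 (real n)) (\<lambda>(w, x). - complex_of_real x * exp (- w * complex_of_real x) * g x)"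
        unfolding split_def
        by (intro continuous_intros continuous_on_compose2[OF cont]) auto
      show "convex {w. 0 < Re w}" by (rule convex_halfspace_Re_gt)
    qed
    moreover have "integral (cbox 0 (real n)) (\<lambda>x. exp (- w * complex_of_real x) * g x) = L n w" for w
    proof -
      have "set_integrable lborel {0..real n} (\<lambda>x. exp (- w * complex_of_real x) * g x)"
        by (intro borel_integrable_atLeastAtMost' continuous_intros contg)
      from set_borel_integral_eq_integral(2)[OF this] show ?thesis
        unfolding L_def set_lebesgue_integral_def box_real
        by (subst Bochner_Integration.integral_cong[OF refl, where g = "\<lambda>x. indicator {0..real n} x *\<^sub>R (exp (- w * complex_of_real x) * g x)"])
           (auto split: split_indicator)
    qed
    ultimately show ?thesis by (simp cong: holomorphic_cong)
  qed
  fix w0 :: complex assume "w0 \<in> {w. 0 < Re w}"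
  then have w0: "0 < Re w0" by simp
  \<comment> \<open>With this radius the disc about \<open>w0\<close> stays in
    \<open>Re w >= c\<close>, so the integrand at the real point \<open>c\<close> dominates in
    modulus those at all points of the disc; this is \<open>h\<close> below.\<close>
  define c where "c = Re w0 / 2"
  have c: "0 < c" using w0 by (simp add: c_def)
  have Re_ge: "c \<le> Re w" if "w \<in> cball w0 c" for w
    using that abs_Re_le_cmod[of "w0 - w"] by (simp add: c_def dist_norm)
  define h where "h x = norm (indicator {0..} x *\<^sub>R (exp (- complex_of_real c * complex_of_real x) * g x))" for x
  have h: "integrable lborel h"
    unfolding h_def using c by (intro integrable_norm integrable_laplace g) simp
  have hn: "integrable lborel (\<lambda>x. indicator {- real n..real n} x *\<^sub>R h x)" for n
    by (rule integrable_mult_indicator[OF _ h]) simp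
  define d where "d n = (LINT x|lborel. h x) - (LINT x:{- real n..real n}|lborel. h x)" for n
  have "d \<longlonglongrightarrow> 0"
    unfolding d_def using tendsto_diff[OF tendsto_const tendsto_integral_symmetric_intervals[OF h], of "LINT x|lborel. h x"] by simp
  have le: "dist (L n w) (laplace_transform g w) \<le> d n" if w: "w \<in> cball w0 c" for n w
  proof -
    let ?F = "\<lambda>x. indicator {0..} x *\<^sub>R (exp (- w * complex_of_real x) * g x)"
    have F: "integrable lborel ?F"
      using Re_ge[OF w] c by (intro integrable_laplace g) simp
    have Fn: "integrable lborel (\<lambda>x. indicator {- real n..real n} x *\<^sub>R ?F x)"
      by (rule integrable_mult_indicator[OF _ F]) simp
    have "dist (L n w) (laplace_transform g w) = norm (LINT x|lborel. ?F x - indicator {- real n..real n} x *\<^sub>R ?F x)"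
      using F Fn by (simp add: L_def laplace_transform_def set_lebesgue_integral_def dist_norm norm_minus_commute)
    also have "\<dots> \<le> (LINT x|lborel. h x - indicator {- real n..real n} x *\<^sub>R h x)"
    proof (rule Bochner_Integration.integral_norm_bound_integral)
      fix x :: real
      have "exp (- Re w * x) * norm (g x) \<le> exp (- c * x) * norm (g x)" if "x \<ge> 0"
        using Re_ge[OF w] that by (intro mult_right_mono) (auto simp: mult_right_mono)
      then show "norm (?F x - indicator {- real n..real n} x *\<^sub>R ?F x) \<le> h x - indicator {- real n..real n} x *\<^sub>R h x"
        by (auto simp: h_def norm_mult split: split_indicator)
    qed (use F Fn h hn in auto)
    also have "\<dots> = d n"
      using h hn by (simp add: d_def set_lebesgue_integral_def)
    finally show ?thesis .
  qed
  show "\<exists>d>0. cball w0 d \<subseteq> {w. 0 < Re w} \<and> uniform_limit (cball w0 d) L (laplace_transform g) sequentially"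
  proof (intro exI conjI)
    show "cball w0 c \<subseteq> {w. 0 < Re w}" using Re_ge c by force
    show "uniform_limit (cball w0 c) L (laplace_transform g) sequentially"
    proof (rule uniform_limitI)
      fix e :: real assume "0 < e"
      then have "\<forall>\<^sub>F n in sequentially. d n < e" using \<open>d \<longlonglongrightarrow> 0\<close> by (simp add: order_tendsto_iff)
      then show "\<forall>\<^sub>F n in sequentially. \<forall>w\<in>cball w0 c. dist (L n w) (laplace_transform g w) < e"
        by eventually_elim (blast intro: le_less_trans[OF le])
    qed
  qed fact
qed

text \<open>The identity theorem carries the equality from the real half-line beyond
  \<open>T\<close>. The condition on \<open>Im w\<close> keeps \<open>w\<close> off the disc
  \<open>|w| <= T\<close> however small \<open>Re w\<close> is, as needed when approaching the
  imaginary axis.\<close>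

lemma laplace_transform_eq_borel_transform:
  assumes a: "\<And>n. cmod (a n) \<le> K * T ^ n" "0 < T"
    and g: "\<And>x. (\<lambda>n. a n / fact n * complex_of_real x ^ n) sums g x"
    and g2: "square_integrable g" and cont: "continuous_on UNIV g"
    and w: "0 < Re w" "T < \<bar>Im w\<bar>"
  shows "laplace_transform g w = borel_transform a w"
proof -
  \<comment> \<open>\<open>A\<close> contains the reals on which both transforms are known to agree, and links \<open>P\<close> and \<open>N\<close>.\<close>
  define A where "A = {w. T < Re w}"
  define P where "P = {w. 0 < Re w} \<inter> {w. T < Im w}"
  define N where "N = {w. 0 < Re w} \<inter> {w. Im w < - T}"
  define D where "D = A \<union> P \<union> N"
  define F where "F w = laplace_transform g w - borel_transform a w" for w
  have Re_D: "0 < Re w" and norm_D: "T < cmod w" if "w \<in> D" for w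
    using that a abs_Re_le_cmod[of w] abs_Im_le_cmod[of w] by (auto simp: D_def A_def P_def N_def)
  have "F w = 0"
  proof (rule analytic_continuation[where f = F and w = w])
    show "F holomorphic_on D"
      unfolding F_def[abs_def]
      by (intro holomorphic_on_diff holomorphic_on_subset[OF laplace_transform_holomorphic[OF g2 cont]]
          holomorphic_on_subset[OF borel_transform_holomorphic[OF a]]) (use Re_D norm_D in auto)
    show "open D"
      unfolding D_def A_def P_def N_def
      by (intro open_Un open_Int open_halfspace_Re_gt open_halfspace_Im_gt open_halfspace_Im_lt)
    \<comment> \<open>\<open>P\<close> and \<open>N\<close> are disjoint; each is attached to
      \<open>A\<close> through an explicit common point.\<close>
    have "Complex (T + 1) (T + 1) \<in> A \<inter> P" "Complex (T + 1) (- T - 1) \<in> (A \<union> P) \<inter> N"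
      using a by (auto simp: A_def P_def N_def)
    moreover have "connected A" "connected P" "connected N"
      unfolding A_def P_def N_def
      by (intro convex_connected convex_Int convex_halfspace_Re_gt convex_halfspace_Im_gt convex_halfspace_Im_lt)+
    ultimately show "connected D"
      unfolding D_def by (intro connected_Un) auto
    show "complex_of_real ` {T<..} \<subseteq> D" by (auto simp: D_def A_def)
    show "complex_of_real (T + 1) \<in> D" by (auto simp: D_def A_def)
    show "complex_of_real (T + 1) islimpt complex_of_real ` {T<..}"
      by (intro islimpt_isCont_image) (auto intro!: interior_limit_point simp: eventually_at_filter interior_open simp del: of_real_add)
    show "F z = 0" if "z \<in> complex_of_real ` {T<..}" for z
      using that laplace_transform_eq_borel_transform_real[OF a _ g] by (auto simp: F_def)
    show "w \<in> D" using w by (auto simp: D_def P_def N_def)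
  qed
  then show ?thesis by (simp add: F_def)
qed

text \<open>The line is split at 0. The right half is a Laplace transform at \<epsilon> + i \<xi>;
  the left half, after reflection, is that of \<open>g (- x)\<close> at \<epsilon> - i \<xi>, with
  Taylor coefficients \<open>(- 1) ^ n * a n\<close>. The alternating signs and the odd parity left
  over from \<open>Suc n\<close> produce minus the Borel transform at - \<epsilon> + i
  \<xi>.\<close>

lemma abel_fourier_integral_eq_borel_transform:
  fixes \<epsilon> \<xi> :: real
  assumes a: "\<And>n. cmod (a n) \<le> K * T ^ n" "0 < T"
    and g: "\<And>x. (\<lambda>n. a n / fact n * complex_of_real x ^ n) sums g x"
    and g2: "square_integrable g" and cont: "continuous_on UNIV g"
    and \<epsilon>: "0 < \<epsilon>" and \<xi>: "T < \<bar>\<xi>\<bar>"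
  shows "integrable lborel (\<lambda>x. exp (- \<i> * complex_of_real (\<xi> * x)) * (complex_of_real (exp (- \<epsilon> * \<bar>x\<bar>)) * g x))"
    and "(LINT x|lborel. exp (- \<i> * complex_of_real (\<xi> * x)) * (complex_of_real (exp (- \<epsilon> * \<bar>x\<bar>)) * g x))
      = borel_transform a (Complex \<epsilon> \<xi>) - borel_transform a (Complex (- \<epsilon>) \<xi>)"
proof -
  define b where "b n = (- 1) ^ n * a n" for n
  have b: "cmod (b n) \<le> K * T ^ n" for n
    using a(1)[of n] by (simp add: b_def norm_mult norm_power)
  have gm: "(\<lambda>n. b n / fact n * complex_of_real x ^ n) sums g (- x)" for x
    using g[of "- x"] by (simp add: b_def power_minus[of "complex_of_real x"] mult_ac)
  have gm2: "square_integrable (\<lambda>x. g (- x))"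
    using g2 lborel_integrable_real_affine[of "\<lambda>x. (cmod (g x))\<^sup>2" "-1" 0] by (auto simp: square_integrable_def)
  have contm: "continuous_on UNIV (\<lambda>x. g (- x))"
    by (intro continuous_on_compose2[OF cont] continuous_intros) auto
  define E where "E x = exp (- \<i> * complex_of_real (\<xi> * x)) * (complex_of_real (exp (- \<epsilon> * \<bar>x\<bar>)) * g x)" for x
  have E1: "indicator {0..} x *\<^sub>R (exp (- Complex \<epsilon> \<xi> * complex_of_real x) * g x) = indicator {0..} x *\<^sub>R E x" for x
    by (auto simp: E_def indicator_def Complex_eq algebra_simps exp_add exp_diff exp_minus divide_inverse simp flip: exp_of_real)
  have E2: "indicator {0..} x *\<^sub>R (exp (- Complex \<epsilon> (- \<xi>) * complex_of_real x) * g (- x)) = indicator {0..} x *\<^sub>R E (- x)" for x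
    by (auto simp: E_def indicator_def Complex_eq algebra_simps exp_add exp_diff exp_minus divide_inverse simp flip: exp_of_real)
  have I1: "integrable lborel (\<lambda>x. indicator {0..} x *\<^sub>R E x)"
    using integrable_laplace[OF g2, of "Complex \<epsilon> \<xi>"] \<epsilon> unfolding E1 by simp
  have I2: "integrable lborel (\<lambda>x. indicator {0..} x *\<^sub>R E (- x))"
    using integrable_laplace[OF gm2, of "Complex \<epsilon> (- \<xi>)"] \<epsilon> unfolding E2 by simp
  then have I2': "integrable lborel (\<lambda>x. indicator {0..} (- x) *\<^sub>R E x)"
    using lborel_integrable_real_affine[of "\<lambda>x. indicator {0..} x *\<^sub>R E (- x)" "-1" 0] by simp
  \<comment> \<open>Both closed half-lines contain 0, so the splitting fails to be exact at that
    single point.\<close>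
  have AE: "AE x in lborel. indicator {0..} x *\<^sub>R E x + indicator {0..} (- x) *\<^sub>R E x = E x"
    using AE_lborel_singleton[of "0::real"] by eventually_elim (auto split: split_indicator)
  have [measurable]: "g \<in> borel_measurable borel" using g2 by (auto simp: square_integrable_def)
  have [measurable]: "E \<in> borel_measurable borel" unfolding E_def[abs_def] by measurable
  have "integrable lborel E"
    using Bochner_Integration.integrable_add[OF I1 I2'] by (rule integrable_cong_AE_imp) (use AE in auto)
  then show "integrable lborel (\<lambda>x. exp (- \<i> * complex_of_real (\<xi> * x)) * (complex_of_real (exp (- \<epsilon> * \<bar>x\<bar>)) * g x))"
    by (simp add: E_def[abs_def])
  have "(LINT x|lborel. E x) = (LINT x|lborel. indicator {0..} x *\<^sub>R E x + indicator {0..} (- x) *\<^sub>R E x)"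
    by (rule integral_cong_AE) (use AE in auto)
  also have "\<dots> = (LINT x|lborel. indicator {0..} x *\<^sub>R E x) + (LINT x|lborel. indicator {0..} (- x) *\<^sub>R E x)"
    using I1 I2' by simp
  also have "(LINT x|lborel. indicator {0..} (- x) *\<^sub>R E x) = (LINT x|lborel. indicator {0..} x *\<^sub>R E (- x))"
    using lborel_integral_real_affine[of "-1" "\<lambda>x. indicator {0..} x *\<^sub>R E (- x)" 0] by simp
  also have "(LINT x|lborel. indicator {0..} x *\<^sub>R E x) = laplace_transform g (Complex \<epsilon> \<xi>)"
    by (simp only: laplace_transform_def set_lebesgue_integral_def E1)
  also have "(LINT x|lborel. indicator {0..} x *\<^sub>R E (- x)) = laplace_transform (\<lambda>x. g (- x)) (Complex \<epsilon> (- \<xi>))"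
    by (simp only: laplace_transform_def set_lebesgue_integral_def E2)
  also have "laplace_transform g (Complex \<epsilon> \<xi>) = borel_transform a (Complex \<epsilon> \<xi>)"
    using \<epsilon> \<xi> by (intro laplace_transform_eq_borel_transform[OF a g g2 cont]) auto
  also have "laplace_transform (\<lambda>x. g (- x)) (Complex \<epsilon> (- \<xi>)) = borel_transform b (Complex \<epsilon> (- \<xi>))"
    using \<epsilon> \<xi> by (intro laplace_transform_eq_borel_transform[OF b a(2) gm gm2 contm]) auto
  also have "\<dots> = - borel_transform a (Complex (- \<epsilon>) \<xi>)"
  proof -
    have "T < cmod (Complex (- \<epsilon>) \<xi>)"
      using \<xi> abs_Im_le_cmod[of "Complex (- \<epsilon>) \<xi>"] by simp
    from sums_minus[OF borel_transform_sums[OF a this]]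
    have "(\<lambda>n. - (a n / Complex (- \<epsilon>) \<xi> ^ Suc n)) sums - borel_transform a (Complex (- \<epsilon>) \<xi>)" .
    moreover have "- (a n / Complex (- \<epsilon>) \<xi> ^ Suc n) = b n / Complex \<epsilon> (- \<xi>) ^ Suc n" for n
    proof -
      have "Complex (- \<epsilon>) \<xi> = - Complex \<epsilon> (- \<xi>)" by (simp add: complex_eq_iff)
      then show ?thesis
        by (simp add: b_def power_minus[of "Complex \<epsilon> (- \<xi>)"] minus_one_power_iff)
    qed
    ultimately show ?thesis by (simp add: borel_transform_def sums_iff)
  qed
  finally show "(LINT x|lborel. exp (- \<i> * complex_of_real (\<xi> * x)) * (complex_of_real (exp (- \<epsilon> * \<bar>x\<bar>)) * g x))
      = borel_transform a (Complex \<epsilon> \<xi>) - borel_transform a (Complex (- \<epsilon>) \<xi>)"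
    by (simp add: E_def)
qed

subsection \<open>Support of the Fourier transform\<close>

lemma square_integrable_if_decay:
  assumes [measurable]: "h \<in> borel_measurable borel"
    and A: "\<And>x. cmod (h x) \<le> A" and B: "\<And>x. \<bar>x\<bar> * cmod (h x) \<le> B"
  shows "square_integrable h"
  unfolding square_integrable_def
proof
  have "set_integrable lborel (einterval (-\<infinity>) \<infinity>) (\<lambda>x. inverse (1 + x\<^sup>2))"
    by (rule integrable_inverse_1_plus_square)
  then have "integrable lborel (\<lambda>x::real. inverse (1 + x\<^sup>2))"
    by (simp add: set_integrable_def)
  then have "integrable lborel (\<lambda>x::real. (A\<^sup>2 + B\<^sup>2) * inverse (1 + x\<^sup>2))"
    by simp
  then show "integrable lborel (\<lambda>x. (cmod (h x))\<^sup>2)"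
  proof (rule Bochner_Integration.integrable_bound)
    have "(cmod (h x))\<^sup>2 \<le> (A\<^sup>2 + B\<^sup>2) * inverse (1 + x\<^sup>2)" for x
    proof -
      have "(cmod (h x))\<^sup>2 \<le> A\<^sup>2" using A[of x] by (intro power_mono) auto
      moreover have "(\<bar>x\<bar> * cmod (h x))\<^sup>2 \<le> B\<^sup>2" using B[of x] by (intro power_mono) auto
      ultimately have "(cmod (h x))\<^sup>2 * (1 + x\<^sup>2) \<le> A\<^sup>2 + B\<^sup>2"
        by (simp add: power_mult_distrib algebra_simps)
      moreover have "0 < 1 + x\<^sup>2" by (simp add: add_pos_nonneg)
      ultimately show ?thesis by (simp add: field_simps)
    qed
    then show "AE x in lborel. norm ((cmod (h x))\<^sup>2) \<le> norm ((A\<^sup>2 + B\<^sup>2) * inverse (1 + x\<^sup>2))"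
      by (intro AE_I2) (auto intro: order_trans[OF _ abs_ge_self])
  qed measurable
qed measurable

lemma fourier_L1_interval:
  fixes \<phi> :: "real \<Rightarrow> complex"
  assumes "continuous_on {a..b} \<phi>"
  shows "fourier_L1 (\<lambda>u. indicator {a..b} u *\<^sub>R \<phi> u) x
    = complex_of_real (1 / sqrt (2 * pi)) * integral {a..b} (\<lambda>u. exp (- \<i> * complex_of_real (x * u)) * \<phi> u)"
proof -
  have "set_integrable lborel {a..b} (\<lambda>u. exp (- \<i> * complex_of_real (x * u)) * \<phi> u)"
    by (intro borel_integrable_atLeastAtMost' continuous_intros assms)
  from set_borel_integral_eq_integral(2)[OF this] show ?thesis
    by (simp add: fourier_L1_def set_lebesgue_integral_def)
qed

text \<open>One integration by parts gives decay of order \<open>1 / \<bar>x\<bar>\<close>, enough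
  for square integrability. Boundary terms are kept, so interval indicators (\<phi> constant) are
  covered together with test functions.\<close>

lemma square_integrable_fourier_L1_C1:
  fixes \<phi> \<phi>' :: "real \<Rightarrow> complex"
  assumes "a \<le> b" and d: "\<And>u. u \<in> {a..b} \<Longrightarrow> (\<phi> has_vector_derivative \<phi>' u) (at u)"
    and cont': "continuous_on {a..b} \<phi>'"
  shows "square_integrable (fourier_L1 (\<lambda>u. indicator {a..b} u *\<^sub>R \<phi> u))"
proof -
  define c where "c = complex_of_real (1 / sqrt (2 * pi))"
  define G where "G x = integral {a..b} (\<lambda>u. exp (- \<i> * complex_of_real (x * u)) * \<phi> u)" for x
  have cont: "continuous_on {a..b} \<phi>"
    by (rule continuous_on_vector_derivative) (use d has_vector_derivative_at_within in blast)
  obtain M where M: "\<And>u. u \<in> {a..b} \<Longrightarrow> cmod (\<phi> u) \<le> M"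
    using compact_imp_bounded[OF compact_continuous_image[OF cont compact_Icc]]
    unfolding bounded_iff by blast
  obtain M' where M': "\<And>u. u \<in> {a..b} \<Longrightarrow> cmod (\<phi>' u) \<le> M'"
    using compact_imp_bounded[OF compact_continuous_image[OF cont' compact_Icc]]
    unfolding bounded_iff by blast
  have FG: "fourier_L1 (\<lambda>u. indicator {a..b} u *\<^sub>R \<phi> u) x = c * G x" for x
    unfolding fourier_L1_interval[OF cont] c_def G_def ..
  have G: "cmod (G x) \<le> M * (b - a)" for x
    unfolding G_def
    by (rule integral_bound[OF \<open>a \<le> b\<close>])
       (use M in \<open>auto intro!: continuous_intros cont simp: norm_mult\<close>)
  have xG: "\<bar>x\<bar> * cmod (G x) \<le> 2 * M + M' * (b - a)" for x
  proof -
    let ?e = "\<lambda>u. exp (- \<i> * complex_of_real (x * u))"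
    have i1: "(\<lambda>u. ?e u * \<phi> u) integrable_on {a..b}" and i2: "(\<lambda>u. ?e u * \<phi>' u) integrable_on {a..b}"
      by (intro integrable_continuous_interval continuous_intros cont cont')+
    \<comment> \<open>Integration by parts, as the fundamental theorem of calculus for the product.
      The endpoints contribute \<open>2 * M\<close> to the bound and the derivative of \<phi>
      contributes \<open>M' * (b - a)\<close>.\<close>
    have "((\<lambda>u. (- \<i> * x) * (?e u * \<phi> u) + ?e u * \<phi>' u) has_integral (?e b * \<phi> b - ?e a * \<phi> a)) {a..b}"
    proof (rule fundamental_theorem_of_calculus[OF \<open>a \<le> b\<close>])
      fix u assume u: "u \<in> {a..b}"
      have "((\<lambda>u. exp ((- \<i> * x) * complex_of_real u)) has_vector_derivative (- \<i> * x) * exp ((- \<i> * x) * complex_of_real u)) (at u within {a..b})"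
        by (rule has_vector_derivative_real_field) (auto intro!: derivative_eq_intros)
      then have "(?e has_vector_derivative (- \<i> * x) * ?e u) (at u within {a..b})"
        by (simp add: mult_ac)
      from has_vector_derivative_mult[OF this has_vector_derivative_at_within[OF d[OF u]]]
      show "((\<lambda>u. ?e u * \<phi> u) has_vector_derivative (- \<i> * x) * (?e u * \<phi> u) + ?e u * \<phi>' u) (at u within {a..b})"
        by (simp add: algebra_simps)
    qed
    then have "(- \<i> * x) * G x + integral {a..b} (\<lambda>u. ?e u * \<phi>' u) = ?e b * \<phi> b - ?e a * \<phi> a"
      using has_integral_add[OF has_integral_mult_right[OF integrable_integral[OF i1], of "- \<i> * x"] integrable_integral[OF i2]]
      unfolding G_def by (rule has_integral_unique[rotated])
    then have "(- \<i> * x) * G x = (?e b * \<phi> b - ?e a * \<phi> a) - integral {a..b} (\<lambda>u. ?e u * \<phi>' u)"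
      by (simp only: eq_diff_eq)
    then have "\<bar>x\<bar> * cmod (G x) = cmod ((?e b * \<phi> b - ?e a * \<phi> a) - integral {a..b} (\<lambda>u. ?e u * \<phi>' u))"
      by (metis norm_mult norm_minus_cancel norm_ii mult_1 norm_of_real)
    also have "\<dots> \<le> (cmod (?e b * \<phi> b) + cmod (?e a * \<phi> a)) + cmod (integral {a..b} (\<lambda>u. ?e u * \<phi>' u))"
      by (intro order_trans[OF norm_triangle_ineq4] add_right_mono norm_triangle_ineq4)
    also have "\<dots> \<le> (M + M) + M' * (b - a)"
    proof (intro add_mono)
      show "cmod (?e b * \<phi> b) \<le> M" "cmod (?e a * \<phi> a) \<le> M"
        using M[of a] M[of b] \<open>a \<le> b\<close> by (simp_all add: norm_mult)
      show "cmod (integral {a..b} (\<lambda>u. ?e u * \<phi>' u)) \<le> M' * (b - a)"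
        by (rule integral_bound[OF \<open>a \<le> b\<close>])
           (use M' in \<open>auto intro!: continuous_intros cont' simp: norm_mult\<close>)
    qed
    finally show ?thesis by simp
  qed
  show ?thesis
  proof (rule square_integrable_if_decay)
    have "(\<lambda>u. indicator {a..b} u *\<^sub>R \<phi> u) \<in> borel_measurable borel"
      by (intro borel_measurable_continuous_on_indicator cont) simp
    then show "fourier_L1 (\<lambda>u. indicator {a..b} u *\<^sub>R \<phi> u) \<in> borel_measurable borel"
      by (rule fourier_L1_measurable)
    show "cmod (fourier_L1 (\<lambda>u. indicator {a..b} u *\<^sub>R \<phi> u) x) \<le> cmod c * (M * (b - a))" for x
      unfolding FG norm_mult by (intro mult_left_mono G) simp
    show "\<bar>x\<bar> * cmod (fourier_L1 (\<lambda>u. indicator {a..b} u *\<^sub>R \<phi> u) x) \<le> cmod c * (2 * M + M' * (b - a))" for x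
      using mult_left_mono[OF xG[of x], of "cmod c"] unfolding FG norm_mult by (simp add: mult_ac)
  qed
qed

lemma PW_D:
  assumes "f \<in> PW t"
  shows "f holomorphic_on UNIV" "square_integrable (\<lambda>x. f (complex_of_real x))"
    "continuous_on UNIV (\<lambda>x. f (complex_of_real x))"
    and "t < S \<Longrightarrow> \<exists>C. \<forall>z. cmod (f z) \<le> C * exp (S * cmod z)"
proof -
  show hol: "f holomorphic_on UNIV" and "square_integrable (\<lambda>x. f (complex_of_real x))"
    using assms by (auto simp: PW_def)
  show "continuous_on UNIV (\<lambda>x. f (complex_of_real x))"
    by (rule continuous_on_compose2[OF holomorphic_on_imp_continuous_on[OF hol]]) (auto intro: continuous_intros)
  show "\<exists>C. \<forall>z. cmod (f z) \<le> C * exp (S * cmod z)" if "t < S"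
    using assms that unfolding PW_def exp_type_le_def
    by (auto dest!: spec[of _ "S - t"]) blast
qed

text \<open>One sequence is evaluated twice: fact \<open>1\<close> follows the pairings of the
  Abel-regularised functions \<open>h n\<close> with the transform of the indicator
  \<open>G\<close>, and fact \<open>2\<close> follows the same numbers after the transform has been
  moved onto \<open>h n\<close>.\<close>

lemma PW_interval_integral_fourier_zero:
  assumes f: "f \<in> PW t" and "0 < t" and F: "is_L2_fourier (\<lambda>x. f (complex_of_real x)) \<psi>"
    and "t < r" "a \<le> b" and ab: "\<And>u. u \<in> {a..b} \<Longrightarrow> r \<le> \<bar>u\<bar>"
  shows "(LINT u:{a..b}|lborel. \<psi> u) = 0"
proof -
  \<comment> \<open>Two intermediate rates \<open>t < S < T < r\<close>: \<open>S\<close> bounds the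
    growth of \<open>f\<close>, \<open>T\<close> the growth of its derivatives at 0, and the gap
    between \<open>T\<close> and \<open>r\<close> gives the uniform Borel bound.\<close>
  define S where "S = (2 * t + r) / 3"
  define T where "T = (t + 2 * r) / 3"
  have ST: "t < S" "S < T" "T < r" "0 < T" using \<open>t < r\<close> \<open>0 < t\<close> by (auto simp: S_def T_def)
  obtain C where C: "\<And>z. cmod (f z) \<le> C * exp (S * cmod z)"
    using PW_D(4)[OF f \<open>t < S\<close>] by blast
  define g where "g x = f (complex_of_real x)" for x
  have g2: "square_integrable g" and gc: "continuous_on UNIV g"
    using PW_D(2,3)[OF f] by (auto simp: g_def[abs_def])
  define \<alpha> where "\<alpha> n = (deriv ^^ n) f 0" for n
  define K where "K = C / (T - S) * T"
  have \<alpha>: "cmod (\<alpha> n) \<le> K * T ^ n" for n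
    using deriv_bound_exp_type[OF PW_D(1)[OF f] C \<open>0 < T\<close> \<open>S < T\<close>, of n] by (simp add: \<alpha>_def K_def)
  have gs: "(\<lambda>n. \<alpha> n / fact n * complex_of_real x ^ n) sums g x" for x
    using holomorphic_power_series[of f 0 "\<bar>x\<bar> + 1" "complex_of_real x"] holomorphic_on_subset[OF PW_D(1)[OF f]]
    by (simp add: \<alpha>_def g_def)
  define c where "c = complex_of_real (1 / sqrt (2 * pi))"
  define e where "e n = 1 / real (Suc n)" for n
  have e: "0 < e n" for n by (simp add: e_def)
  have e0: "e \<longlonglongrightarrow> 0" unfolding e_def using LIMSEQ_inverse_real_of_nat by (simp add: inverse_eq_divide)
  have [measurable]: "g \<in> borel_measurable borel" using g2 by (auto simp: square_integrable_def)
  define h where "h n x = complex_of_real (exp (- e n * \<bar>x\<bar>)) * g x" for n x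
  \<comment> \<open>Integrability is read off from the Abel integral at the frequency
    \<open>r\<close>, which exceeds \<open>T\<close>; the oscillating factor does not change the
    norm.\<close>
  have hi: "integrable lborel (h n)" for n
  proof (rule Bochner_Integration.integrable_bound)
    show "integrable lborel (\<lambda>x. exp (- \<i> * complex_of_real (r * x)) * (complex_of_real (exp (- e n * \<bar>x\<bar>)) * g x))"
      using ST by (intro abel_fourier_integral_eq_borel_transform(1)[OF \<alpha> \<open>0 < T\<close> gs g2 gc e]) auto
  qed (auto simp: h_def[abs_def] norm_mult)
  have Fh: "fourier_L1 (h n) u = c * (borel_transform \<alpha> (Complex (e n) u) - borel_transform \<alpha> (Complex (- e n) u))"
    if "r \<le> \<bar>u\<bar>" for n u
    using ST that abel_fourier_integral_eq_borel_transform(2)[OF \<alpha> \<open>0 < T\<close> gs g2 gc e[of n], of u]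
    by (simp add: fourier_L1_def h_def c_def)
  define G where "G u = indicator {a..b} u *\<^sub>R (1::complex)" for u
  have [measurable]: "G \<in> borel_measurable borel" unfolding G_def[abs_def] by measurable
  have Gi: "integrable lborel G"
    unfolding G_def[abs_def] by (rule borel_integrable_compact) auto
  have G2: "square_integrable G"
    unfolding G_def[abs_def] by (rule square_integrable_indicator)
  have FG: "square_integrable (fourier_L1 G)"
    unfolding G_def[abs_def]
    by (rule square_integrable_fourier_L1_C1[OF \<open>a \<le> b\<close>, where \<phi>' = "\<lambda>_. 0"]) (auto intro: derivative_intros)
  have gFG: "integrable lborel (\<lambda>x. g x * fourier_L1 G x)"
    by (rule square_integrable_integrable_mult[OF g2 FG])
  have 1: "(\<lambda>n. LINT x|lborel. h n x * fourier_L1 G x) \<longlonglongrightarrow> (LINT x|lborel. g x * fourier_L1 G x)"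
  proof (rule integral_dominated_convergence[where w = "\<lambda>x. norm (g x * fourier_L1 G x)"])
    show "AE x in lborel. (\<lambda>n. h n x * fourier_L1 G x) \<longlonglongrightarrow> g x * fourier_L1 G x"
    proof (rule AE_I2)
      fix x
      have "(\<lambda>n. complex_of_real (exp (- e n * \<bar>x\<bar>)) * g x * fourier_L1 G x)
          \<longlonglongrightarrow> complex_of_real (exp (- 0 * \<bar>x\<bar>)) * g x * fourier_L1 G x"
        by (intro tendsto_intros e0)
      then show "(\<lambda>n. h n x * fourier_L1 G x) \<longlonglongrightarrow> g x * fourier_L1 G x"
        by (simp add: h_def)
    qed
    show "AE x in lborel. norm (h n x * fourier_L1 G x) \<le> norm (g x * fourier_L1 G x)" for n
      using e[of n] by (intro AE_I2) (auto simp: h_def norm_mult intro!: mult_right_mono mult_left_le_one_le)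
    show "(\<lambda>x. h n x * fourier_L1 G x) \<in> borel_measurable lborel" for n
      unfolding h_def by measurable
  qed (use gFG in auto)
  have 2: "(\<lambda>n. LINT u|lborel. fourier_L1 (h n) u * G u) \<longlonglongrightarrow> integral\<^sup>L lborel (\<lambda>u::real. 0)"
  proof (rule integral_dominated_convergence[where w = "\<lambda>u. cmod c * (2 * K / (r - T)) * indicator {a..b} u"])
    show "AE u in lborel. (\<lambda>n. fourier_L1 (h n) u * G u) \<longlonglongrightarrow> 0"
    proof (rule AE_I2)
      fix u
      show "(\<lambda>n. fourier_L1 (h n) u * G u) \<longlonglongrightarrow> 0"
      proof (cases "u \<in> {a..b}")
        case True
        \<comment> \<open>The Borel transform is continuous across the imaginary axis at height
          \<open>u\<close>, so its values from the two sides have the same limit and cancel.\<close>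
        have "continuous_on {w. T < cmod w} (borel_transform \<alpha>)"
          by (rule holomorphic_on_imp_continuous_on[OF borel_transform_holomorphic[OF \<alpha> \<open>0 < T\<close>]])
        moreover have "open {w. T < cmod w}"
          by (intro open_Collect_less continuous_intros)
        moreover have "Complex 0 u \<in> {w. T < cmod w}"
          using ab[OF True] ST abs_Im_le_cmod[of "Complex 0 u"] by simp
        ultimately have ic: "isCont (borel_transform \<alpha>) (Complex 0 u)"
          using continuous_on_eq_continuous_at by blast
        have "(\<lambda>n. - e n) \<longlonglongrightarrow> 0" using tendsto_minus[OF e0] by simp
        then have "(\<lambda>n. c * (borel_transform \<alpha> (Complex (e n) u) - borel_transform \<alpha> (Complex (- e n) u)) * G u)
            \<longlonglongrightarrow> c * (borel_transform \<alpha> (Complex 0 u) - borel_transform \<alpha> (Complex 0 u)) * G u"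
          by (intro tendsto_intros isCont_tendsto_compose[OF ic] e0)
        then show ?thesis by (simp add: Fh[OF ab[OF True]])
      qed (simp add: G_def)
    qed
    show "AE u in lborel. norm (fourier_L1 (h n) u * G u) \<le> cmod c * (2 * K / (r - T)) * indicator {a..b} u" for n
    proof (rule AE_I2)
      fix u
      show "norm (fourier_L1 (h n) u * G u) \<le> cmod c * (2 * K / (r - T)) * indicator {a..b} u"
      proof (cases "u \<in> {a..b}")
        case True
        have B: "cmod (borel_transform \<alpha> w) \<le> K / (r - T)" if "r \<le> cmod w" for w
          by (rule borel_transform_bound[OF \<alpha> \<open>0 < T\<close> \<open>T < r\<close> that])
        have "cmod (borel_transform \<alpha> (Complex (e n) u) - borel_transform \<alpha> (Complex (- e n) u)) \<le> K / (r - T) + K / (r - T)"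
          using ab[OF True] abs_Im_le_cmod[of "Complex (e n) u"] abs_Im_le_cmod[of "Complex (- e n) u"]
          by (intro order_trans[OF norm_triangle_ineq4] add_mono B) auto
        from mult_left_mono[OF this norm_ge_zero[of c]] show ?thesis
          using True by (simp add: Fh[OF ab[OF True]] G_def norm_mult)
      qed (simp add: G_def)
    qed
    show "(\<lambda>u. fourier_L1 (h n) u * G u) \<in> borel_measurable lborel" for n
      using fourier_L1_multiplication_formula(1)[OF hi Gi] by (rule borel_measurable_integrable)
    show "integrable lborel (\<lambda>u. cmod c * (2 * K / (r - T)) * indicator {a..b} u)"
      by (intro integrable_mult_right integrable_real_indicator) (auto simp: emeasure_lborel_Icc_eq)
  qed simp
  have "(LINT u:{a..b}|lborel. \<psi> u) = (LINT u|lborel. \<psi> u * G u)"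
    unfolding set_lebesgue_integral_def G_def by (intro Bochner_Integration.integral_cong) auto
  also have "\<dots> = (LINT x|lborel. g x * fourier_L1 G x)"
    unfolding g_def by (rule L2_fourier_multiplication_formula[OF F Gi G2 FG])
  also have "\<dots> = 0"
    using LIMSEQ_unique[OF 1] 2 by (simp add: fourier_L1_multiplication_formula(2)[OF hi Gi])
  finally show ?thesis .
qed

text \<open>Vanishing integrals over subintervals make \<psi> null on each compact interval away
  from \<open>[-t, t]\<close>; countably many such intervals exhaust the complement.\<close>

theorem PW_fourier_support:
  assumes f: "f \<in> PW t" and "0 < t" and F: "is_L2_fourier (\<lambda>x. f (complex_of_real x)) \<psi>"
  shows "AE \<xi> in lborel. \<xi> \<notin> {-t..t} \<longrightarrow> \<psi> \<xi> = 0"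
proof -
  have \<psi>: "square_integrable \<psi>" using F by (simp add: is_L2_fourier_def)
  \<comment> \<open>At this stage \<psi> is known to be integrable only locally; the indicator makes
    it integrable on the line.\<close>
  have zero: "AE u in lborel. indicator {c..d} u *\<^sub>R \<psi> u = 0"
    if "t < r" and r: "\<And>u. u \<in> {c..d} \<Longrightarrow> r \<le> \<bar>u\<bar>" for r c d
  proof (rule AE_zero_if_interval_integrals_zero[OF square_integrable_integrable_on_interval[OF \<psi>]])
    fix a b
    have "(LINT u:{a..b}|lborel. indicator {c..d} u *\<^sub>R \<psi> u) = (LINT u:{max a c..min b d}|lborel. \<psi> u)"
      unfolding set_lebesgue_integral_def by (intro Bochner_Integration.integral_cong) (auto split: split_indicator)
    also have "\<dots> = 0"
    proof (cases "max a c \<le> min b d")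
      case True
      then show ?thesis
        by (rule PW_interval_integral_fourier_zero[OF f \<open>0 < t\<close> F \<open>t < r\<close>]) (use r in auto)
    qed (auto simp: set_lebesgue_integral_def)
    finally show "(LINT u:{a..b}|lborel. indicator {c..d} u *\<^sub>R \<psi> u) = 0" .
  qed
  \<comment> \<open>\<open>r n\<close> decreases to \<open>t\<close>, so the intervals from
    \<open>r n\<close> to \<open>n\<close> and their mirror images cover the complement; those with
    \<open>n < r n\<close> are empty.\<close>
  define r where "r n = t + 1 / real (Suc n)" for n
  have rt: "t < r n" for n by (simp add: r_def)
  have "AE u in lborel. \<forall>n. indicator {r n..real n} u *\<^sub>R \<psi> u = 0 \<and> indicator {- real n..- r n} u *\<^sub>R \<psi> u = 0"
    unfolding AE_all_countable
  proof
    fix n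
    show "AE u in lborel. indicator {r n..real n} u *\<^sub>R \<psi> u = 0 \<and> indicator {- real n..- r n} u *\<^sub>R \<psi> u = 0"
      using zero[OF rt, of "r n" "real n" n] zero[OF rt, of "- real n" "- r n" n] rt[of n] \<open>0 < t\<close>
      by auto
  qed
  then show ?thesis
  proof eventually_elim
    case (elim u)
    show ?case
    proof
      assume "u \<notin> {-t..t}"
      then have u: "0 < \<bar>u\<bar> - t" by auto
      obtain m where m: "1 / real (Suc m) < \<bar>u\<bar> - t"
        using reals_Archimedean[OF u] by (auto simp: inverse_eq_divide)
      obtain k where k: "\<bar>u\<bar> \<le> real k" using real_arch_simple by blast
      have "1 / real (Suc (max m k)) \<le> 1 / real (Suc m)" by (intro divide_left_mono) auto
      then have "r (max m k) \<le> \<bar>u\<bar>" "\<bar>u\<bar> \<le> real (max m k)" using m k by (auto simp: r_def)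
      then have "u \<in> {r (max m k)..real (max m k)} \<or> u \<in> {- real (max m k)..- r (max m k)}" by auto
      then show "\<psi> u = 0" using elim[rule_format, of "max m k"] by (auto simp: indicator_def)
    qed
  qed
qed

subsection \<open>Inversion\<close>

lemma integrable_gaussian:
  fixes b :: real
  assumes "0 < b"
  shows "integrable lborel (\<lambda>v. exp (- b * v\<^sup>2))"
proof -
  \<comment> \<open>The deviation for which the normal density is a multiple of the given
    Gaussian.\<close>
  define \<sigma> where "\<sigma> = 1 / sqrt (2 * b)"
  have \<sigma>: "0 < \<sigma>" "2 * \<sigma>\<^sup>2 = 1 / b" using assms by (auto simp: \<sigma>_def power_divide)
  have "integrable lborel (\<lambda>v. sqrt (2 * pi * \<sigma>\<^sup>2) * normal_density 0 \<sigma> v)"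
    using \<sigma>(1) by (intro integrable_mult_right integrable_normal_density)
  then show ?thesis using \<sigma> by (simp add: normal_density_def mult.commute)
qed

text \<open>Read off from the characteristic function of the standard normal distribution.\<close>

lemma integral_gaussian_iexp:
  "(LINT v|lborel. exp (\<i> * complex_of_real (y * v)) * complex_of_real (exp (- (v\<^sup>2) / 2)))
    = complex_of_real (sqrt (2 * pi) * exp (- (y\<^sup>2) / 2))"
proof -
  have "char std_normal_distribution y = (LINT v|lborel. std_normal_density v *\<^sub>R exp (\<i> * complex_of_real (y * v)))"
    unfolding char_def by (subst integral_density) (auto simp: normal_density_nonneg)
  also have "\<dots> = (LINT v|lborel. complex_of_real (1 / sqrt (2 * pi)) * (exp (\<i> * complex_of_real (y * v)) * complex_of_real (exp (- (v\<^sup>2) / 2))))"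
    by (intro Bochner_Integration.integral_cong) (auto simp: std_normal_density_def scaleR_conv_of_real)
  finally have "complex_of_real (1 / sqrt (2 * pi)) * (LINT v|lborel. exp (\<i> * complex_of_real (y * v)) * complex_of_real (exp (- (v\<^sup>2) / 2)))
      = complex_of_real (exp (- (y\<^sup>2) / 2))"
    by (simp add: char_std_normal_distribution)
  then show ?thesis by (simp add: field_simps)
qed

text \<open>The modulation by \<open>x\<close> moves the centre of the transform to
  \<open>x\<close>. The result has mass \<open>sqrt (2 * pi)\<close> for every \<open>s\<close> and
  concentrates at \<open>x\<close> as \<open>s\<close> tends to 0.\<close>

lemma fourier_L1_modulated_gaussian:
  fixes s x y :: real
  assumes "0 < s"
  shows "fourier_L1 (\<lambda>u. exp (\<i> * complex_of_real (x * u)) * complex_of_real (exp (- ((s * u)\<^sup>2) / 2))) y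
    = complex_of_real (exp (- (((y - x) / s)\<^sup>2) / 2) / s)"
proof -
  let ?h = "\<lambda>v. exp (\<i> * complex_of_real ((x - y) / s * v)) * complex_of_real (exp (- (v\<^sup>2) / 2))"
  have "exp (- \<i> * complex_of_real (y * u)) * (exp (\<i> * complex_of_real (x * u)) * complex_of_real (exp (- ((s * u)\<^sup>2) / 2))) = ?h (0 + s * u)" for u
  proof -
    have arg: "(x - y) / s * (0 + s * u) = x * u - y * u" using assms by (simp add: field_simps)
    show ?thesis unfolding arg by (simp add: algebra_simps flip: exp_add)
  qed
  then have "fourier_L1 (\<lambda>u. exp (\<i> * complex_of_real (x * u)) * complex_of_real (exp (- ((s * u)\<^sup>2) / 2))) y
      = complex_of_real (1 / sqrt (2 * pi)) * (LINT u|lborel. ?h (0 + s * u))"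
    unfolding fourier_L1_def by presburger
  also have "(LINT u|lborel. ?h (0 + s * u)) = complex_of_real (1 / s) * (LINT v|lborel. ?h v)"
    using assms lborel_integral_real_affine[of s ?h 0] by (simp add: scaleR_conv_of_real)
  also have "(LINT v|lborel. ?h v) = complex_of_real (sqrt (2 * pi) * exp (- (((x - y) / s)\<^sup>2) / 2))"
    by (rule integral_gaussian_iexp)
  also have "((x - y) / s)\<^sup>2 = ((y - x) / s)\<^sup>2" by (simp add: power_divide power2_commute)
  finally show ?thesis by simp
qed

text \<open>Gaussian summation: in the multiplication formula with \<open>G n\<close>, the side with
  \<psi> converges by domination, and the other side is a Gaussian average of \<open>f\<close>
  concentrating at \<open>x\<close>. Continuity of \<open>f\<close> yields the identity at every
  point.\<close>

theorem PW_fourier_inversion: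
  assumes f: "f \<in> PW t" and F: "is_L2_fourier (\<lambda>x. f (complex_of_real x)) \<psi>"
    and \<psi>: "integrable lborel \<psi>"
  shows "f (complex_of_real x) = complex_of_real (1 / sqrt (2 * pi)) * (LINT u|lborel. exp (\<i> * complex_of_real (x * u)) * \<psi> u)"
proof -
  define s where "s n = 1 / real (Suc n)" for n
  have s: "0 < s n" "s n \<le> 1" for n by (auto simp: s_def)
  have s0: "s \<longlonglongrightarrow> 0" unfolding s_def using LIMSEQ_inverse_real_of_nat by (simp add: inverse_eq_divide)
  define G where "G n u = exp (\<i> * complex_of_real (x * u)) * complex_of_real (exp (- ((s n * u)\<^sup>2) / 2))" for n u
  have [measurable]: "G n \<in> borel_measurable borel" for n unfolding G_def[abs_def] by measurable
  have normG: "cmod (G n u) = exp (- ((s n)\<^sup>2 / 2) * u\<^sup>2)" for n u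
    by (simp add: G_def norm_mult power_mult_distrib)
  have Gi: "integrable lborel (G n)" for n
  proof -
    have "integrable lborel (\<lambda>u. exp (- ((s n)\<^sup>2 / 2) * u\<^sup>2))"
      using s[of n] by (intro integrable_gaussian) auto
    then show ?thesis
      by (rule Bochner_Integration.integrable_bound) (auto simp: normG)
  qed
  have G2: "square_integrable (G n)" for n
    unfolding square_integrable_def
  proof
    have "integrable lborel (\<lambda>u. exp (- (s n)\<^sup>2 * u\<^sup>2))"
      using s(1)[of n] by (intro integrable_gaussian) auto
    then show "integrable lborel (\<lambda>u. (cmod (G n u))\<^sup>2)"
      unfolding normG by (simp flip: exp_double)
  qed measurable
  have FG: "fourier_L1 (G n) y = complex_of_real (exp (- (((y - x) / s n)\<^sup>2) / 2) / s n)" for n y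
    unfolding G_def[abs_def] by (rule fourier_L1_modulated_gaussian[OF s(1)])
  have FG2: "square_integrable (fourier_L1 (G n))" for n
    unfolding square_integrable_def
  proof
    have "integrable lborel (\<lambda>v::real. exp (- 1 * v\<^sup>2))"
      by (rule integrable_gaussian) simp
    from lborel_integrable_real_affine[OF this, of "1 / s n" "- x / s n"]
    have "integrable lborel (\<lambda>y. exp (- (((y - x) / s n)\<^sup>2)))"
      using s(1)[of n] by (simp add: diff_divide_distrib)
    then have "integrable lborel (\<lambda>y. exp (- (((y - x) / s n)\<^sup>2)) * (1 / (s n)\<^sup>2))"
      by (rule integrable_mult_left)
    also have "(\<lambda>y. exp (- (((y - x) / s n)\<^sup>2)) * (1 / (s n)\<^sup>2)) = (\<lambda>y. (cmod (fourier_L1 (G n) y))\<^sup>2)"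
      unfolding FG norm_of_real by (auto simp: power_divide simp flip: exp_double)
    finally show "integrable lborel (\<lambda>y. (cmod (fourier_L1 (G n) y))\<^sup>2)" .
  qed measurable
  have [measurable]: "\<psi> \<in> borel_measurable borel" using \<psi> by auto
  have 1: "(\<lambda>n. LINT u|lborel. \<psi> u * G n u) \<longlonglongrightarrow> (LINT u|lborel. exp (\<i> * complex_of_real (x * u)) * \<psi> u)"
  proof (rule integral_dominated_convergence[where w = "\<lambda>u. cmod (\<psi> u)"])
    show "AE u in lborel. (\<lambda>n. \<psi> u * G n u) \<longlonglongrightarrow> exp (\<i> * complex_of_real (x * u)) * \<psi> u"
    proof (rule AE_I2)
      fix u
      have "(\<lambda>n. \<psi> u * (exp (\<i> * complex_of_real (x * u)) * complex_of_real (exp (- ((s n * u)\<^sup>2) / 2))))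
          \<longlonglongrightarrow> \<psi> u * (exp (\<i> * complex_of_real (x * u)) * complex_of_real (exp (- ((0 * u)\<^sup>2) / 2)))"
        by (intro tendsto_intros s0) auto
      then show "(\<lambda>n. \<psi> u * G n u) \<longlonglongrightarrow> exp (\<i> * complex_of_real (x * u)) * \<psi> u"
        by (simp add: G_def mult.commute)
    qed
    show "AE u in lborel. norm (\<psi> u * G n u) \<le> cmod (\<psi> u)" for n
      by (intro AE_I2) (auto simp: norm_mult normG intro!: mult_left_le)
  qed (use \<psi> in auto)
  \<comment> \<open>A growth rate above \<open>t\<close> that is positive whatever the sign of
    \<open>t\<close>.\<close>
  define S where "S = max 1 (t + 1)"
  have S: "t < S" "0 < S" by (auto simp: S_def)
  obtain C where C: "\<And>z. cmod (f z) \<le> C * exp (S * cmod z)"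
    using PW_D(4)[OF f S(1)] by blast
  have C0: "0 \<le> C" using order_trans[OF norm_ge_zero C[of 0]] by simp
  have cont: "isCont (\<lambda>x. f (complex_of_real x)) x"
    using PW_D(3)[OF f] by (simp add: continuous_on_eq_continuous_at)
  have [measurable]: "(\<lambda>x. f (complex_of_real x)) \<in> borel_measurable borel"
    by (rule borel_measurable_continuous_onI[OF PW_D(3)[OF f]])
  have eq: "(LINT y|lborel. f (complex_of_real y) * fourier_L1 (G n) y)
      = (LINT v|lborel. f (complex_of_real (x + s n * v)) * complex_of_real (exp (- (v\<^sup>2) / 2)))" for n
  proof -
    have "(LINT y|lborel. f (complex_of_real y) * fourier_L1 (G n) y)
      = s n *\<^sub>R (LINT v|lborel. f (complex_of_real (x + s n * v)) * fourier_L1 (G n) (x + s n * v))"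
      using s(1)[of n] lborel_integral_real_affine[of "s n" "\<lambda>y. f (complex_of_real y) * fourier_L1 (G n) y" x] by simp
    also have "\<dots> = (LINT v|lborel. s n *\<^sub>R (f (complex_of_real (x + s n * v)) * fourier_L1 (G n) (x + s n * v)))"
      by simp
    also have "\<dots> = (LINT v|lborel. f (complex_of_real (x + s n * v)) * complex_of_real (exp (- (v\<^sup>2) / 2)))"
      unfolding FG using s(1)[of n] by (intro Bochner_Integration.integral_cong) (auto simp: scaleR_conv_of_real)
    finally show ?thesis .
  qed
  have 2: "(\<lambda>n. LINT v|lborel. f (complex_of_real (x + s n * v)) * complex_of_real (exp (- (v\<^sup>2) / 2)))
      \<longlonglongrightarrow> (LINT v|lborel. f (complex_of_real x) * complex_of_real (exp (- (v\<^sup>2) / 2)))"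
  proof (rule integral_dominated_convergence[where w = "\<lambda>v. C * exp (S * \<bar>x\<bar> + S\<^sup>2) * exp (- (1/4) * v\<^sup>2)"])
    show "AE v in lborel. (\<lambda>n. f (complex_of_real (x + s n * v)) * complex_of_real (exp (- (v\<^sup>2) / 2)))
        \<longlonglongrightarrow> f (complex_of_real x) * complex_of_real (exp (- (v\<^sup>2) / 2))"
    proof (rule AE_I2)
      fix v
      have "(\<lambda>n. x + s n * v) \<longlonglongrightarrow> x + 0 * v" by (intro tendsto_intros s0)
      then have "(\<lambda>n. x + s n * v) \<longlonglongrightarrow> x" by simp
      then show "(\<lambda>n. f (complex_of_real (x + s n * v)) * complex_of_real (exp (- (v\<^sup>2) / 2)))
        \<longlonglongrightarrow> f (complex_of_real x) * complex_of_real (exp (- (v\<^sup>2) / 2))"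
        by (intro tendsto_mult tendsto_const isCont_tendsto_compose[OF cont])
    qed
    show "AE v in lborel. norm (f (complex_of_real (x + s n * v)) * complex_of_real (exp (- (v\<^sup>2) / 2)))
        \<le> C * exp (S * \<bar>x\<bar> + S\<^sup>2) * exp (- (1/4) * v\<^sup>2)" for n
    proof (rule AE_I2)
      fix v :: real
      have "\<bar>s n * v\<bar> \<le> 1 * \<bar>v\<bar>"
        unfolding abs_mult using s[of n] by (intro mult_right_mono) auto
      then have "S * \<bar>x + s n * v\<bar> \<le> S * \<bar>x\<bar> + S * \<bar>v\<bar>"
        using S(2) by (simp add: flip: distrib_left)
      \<comment> \<open>Expanding this square absorbs the exponential growth of \<open>f\<close>
        into half of the Gaussian exponent, which leaves \<open>exp (- (1/4) * v\<^sup>2)\<close>.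
        Uniformity in \<open>n\<close> comes from \<open>s n <= 1\<close>.\<close>
      moreover have "0 \<le> (S - \<bar>v\<bar> / 2)\<^sup>2" by simp
      then have "S * \<bar>v\<bar> \<le> S\<^sup>2 + v\<^sup>2 / 4" by (simp add: power2_diff power_divide)
      ultimately have "S * \<bar>x + s n * v\<bar> + - (v\<^sup>2) / 2 \<le> (S * \<bar>x\<bar> + S\<^sup>2) + - (1/4) * v\<^sup>2" by simp
      then have "exp (S * \<bar>x + s n * v\<bar>) * exp (- (v\<^sup>2) / 2) \<le> exp (S * \<bar>x\<bar> + S\<^sup>2) * exp (- (1/4) * v\<^sup>2)"
        unfolding exp_add[symmetric] exp_le_cancel_iff .
      then have "C * exp (S * \<bar>x + s n * v\<bar>) * exp (- (v\<^sup>2) / 2) \<le> C * exp (S * \<bar>x\<bar> + S\<^sup>2) * exp (- (1/4) * v\<^sup>2)"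
        using C0 by (simp only: mult.assoc mult_left_mono)
      moreover have "norm (f (complex_of_real (x + s n * v)) * complex_of_real (exp (- (v\<^sup>2) / 2)))
          \<le> C * exp (S * \<bar>x + s n * v\<bar>) * exp (- (v\<^sup>2) / 2)"
        unfolding norm_mult norm_of_real abs_exp_cancel
        using C[of "complex_of_real (x + s n * v)"] by (intro mult_right_mono) (simp_all only: norm_of_real exp_ge_zero)
      ultimately show "norm (f (complex_of_real (x + s n * v)) * complex_of_real (exp (- (v\<^sup>2) / 2)))
          \<le> C * exp (S * \<bar>x\<bar> + S\<^sup>2) * exp (- (1/4) * v\<^sup>2)" by linarith
    qed
    show "integrable lborel (\<lambda>v. C * exp (S * \<bar>x\<bar> + S\<^sup>2) * exp (- (1/4) * v\<^sup>2))"
      by (intro integrable_mult_right integrable_gaussian) simp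
  qed measurable
  have "(LINT v|lborel. f (complex_of_real x) * complex_of_real (exp (- (v\<^sup>2) / 2))) = f (complex_of_real x) * complex_of_real (sqrt (2 * pi))"
    using integral_gaussian_iexp[of 0] by simp
  moreover have "(LINT u|lborel. exp (\<i> * complex_of_real (x * u)) * \<psi> u) = (LINT v|lborel. f (complex_of_real x) * complex_of_real (exp (- (v\<^sup>2) / 2)))"
    using LIMSEQ_unique[OF 1] 2 L2_fourier_multiplication_formula[OF F Gi G2 FG2] by (simp add: eq)
  ultimately have "(LINT u|lborel. exp (\<i> * complex_of_real (x * u)) * \<psi> u) = f (complex_of_real x) * complex_of_real (sqrt (2 * pi))"
    by (rule trans[rotated])
  then show ?thesis by simp
qed

subsection \<open>Pairing with test functions\<close>

text \<open>Reflection realises conjugation on the real line by an entire function; moduli are only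
  moved to conjugate points, so type and square integrability persist.\<close>

lemma PW_cnj:
  assumes "f \<in> PW t"
  shows "cnj \<circ> f \<circ> cnj \<in> PW t"
proof -
  have "(cnj \<circ> f \<circ> cnj) holomorphic_on UNIV"
    using assms by (intro holomorphic_on_compose_cnj_cnj) (auto simp: PW_def intro: holomorphic_on_subset)
  moreover have "exp_type_le (cnj \<circ> f \<circ> cnj) t"
    unfolding exp_type_le_def
  proof (intro allI impI)
    fix \<epsilon> :: real assume "0 < \<epsilon>"
    then obtain C where C: "cmod (f z) \<le> C * exp ((t + \<epsilon>) * cmod z)" for z
      using assms unfolding PW_def exp_type_le_def by blast
    show "\<exists>C. \<forall>z. cmod ((cnj \<circ> f \<circ> cnj) z) \<le> C * exp ((t + \<epsilon>) * cmod z)"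
      using C[of "cnj _"] by (intro exI[of _ C]) simp
  qed
  moreover have "square_integrable (\<lambda>x. (cnj \<circ> f \<circ> cnj) (complex_of_real x))"
  proof -
    have "(\<lambda>x. cnj (f (complex_of_real x))) \<in> borel_measurable borel"
      by (intro borel_measurable_continuous_onI continuous_on_cnj PW_D(3)[OF assms])
    then show ?thesis using assms by (auto simp: PW_def square_integrable_def)
  qed
  ultimately show ?thesis by (simp add: PW_def)
qed

text \<open>Extracts the C1 data needed for integration by parts, and presents \<phi> as its own
  truncation so that the results on truncated functions apply.\<close>

lemma test_fun_on_interval:
  assumes "test_fun_on \<phi> {-t<..<t}"
  obtains \<phi>' where "\<And>u. (\<phi> has_vector_derivative \<phi>' u) (at u)" "continuous_on UNIV \<phi>'"
    "(\<lambda>u. indicator {-t..t} u *\<^sub>R \<phi> u) = \<phi>"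
proof -
  obtain D where D: "D 0 = \<phi>" "\<And>n u. (D n has_vector_derivative D (Suc n) u) (at u)"
    using assms unfolding test_fun_on_def smooth_fun_def by blast
  have d: "(\<phi> has_vector_derivative D (Suc 0) u) (at u)" for u using D(2)[of 0] D(1) by simp
  have c: "continuous_on UNIV (D (Suc 0))"
    using D(2)[of "Suc 0"] by (intro continuous_on_vector_derivative) auto
  have "\<phi> u = 0" if "u \<notin> {-t..t}" for u
    using assms that closure_subset[of "{x. \<phi> x \<noteq> 0}"] by (force simp: test_fun_on_def tsupp_def)
  then have "(\<lambda>u. indicator {-t..t} u *\<^sub>R \<phi> u) = \<phi>" by (auto simp: fun_eq_iff indicator_def)
  with that d c show ?thesis by blast
qed

text \<open>The easy half of Paley-Wiener: the Fourier integral makes sense at complex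
  \<open>z\<close>, where its kernel is at most \<open>exp (t * cmod z)\<close> on
  \<open>[-t, t]\<close>.\<close>

lemma test_fun_fourier_PW:
  assumes "0 < t" and \<phi>: "test_fun_on \<phi> {-t<..<t}"
  obtains F where "F \<in> PW t" "\<And>x. F (complex_of_real x) = fourier_L1 \<phi> x"
proof -
  obtain \<phi>' where d: "\<And>u. (\<phi> has_vector_derivative \<phi>' u) (at u)" and c': "continuous_on UNIV \<phi>'"
    and ind: "(\<lambda>u. indicator {-t..t} u *\<^sub>R \<phi> u) = \<phi>"
    using test_fun_on_interval[OF \<phi>] by blast
  have cont: "continuous_on A \<phi>" for A
    using d by (intro continuous_on_vector_derivative) (auto intro: has_vector_derivative_at_within)
  define c where "c = complex_of_real (1 / sqrt (2 * pi))"
  define F where "F z = c * integral {-t..t} (\<lambda>u. exp (- \<i> * z * complex_of_real u) * \<phi> u)" for z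
  have F: "F (complex_of_real x) = fourier_L1 \<phi> x" for x
    using fourier_L1_interval[OF cont, of "-t" t x] unfolding ind F_def c_def by (simp add: mult.assoc)
  have "(\<lambda>z. integral (cbox (-t) t) (\<lambda>u. exp (- \<i> * z * complex_of_real u) * \<phi> u)) holomorphic_on UNIV"
  proof (rule leibniz_rule_holomorphic)
    show "((\<lambda>z. exp (- \<i> * z * complex_of_real u) * \<phi> u) has_field_derivative
        (- \<i> * complex_of_real u * exp (- \<i> * z * complex_of_real u)) * \<phi> u) (at z within UNIV)" for z u
      by (auto intro!: derivative_eq_intros)
    show "(\<lambda>u. exp (- \<i> * z * complex_of_real u) * \<phi> u) integrable_on cbox (-t) t" for z
      by (intro integrable_continuous continuous_intros cont)
    show "continuous_on (UNIV \<times> cbox (-t) t) (\<lambda>(z, u). - \<i> * complex_of_real u * exp (- \<i> * z * complex_of_real u) * \<phi> u)"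
      unfolding split_def
      by (intro continuous_intros continuous_on_compose2[OF cont[of UNIV]]) auto
  qed simp
  then have "F holomorphic_on UNIV"
    unfolding F_def[abs_def] box_real by (intro holomorphic_intros)
  moreover have "exp_type_le F t"
    unfolding exp_type_le_def
  proof (intro allI impI)
    fix \<epsilon> :: real assume "0 < \<epsilon>"
    obtain M where M: "\<And>u. u \<in> {-t..t} \<Longrightarrow> cmod (\<phi> u) \<le> M"
      using compact_imp_bounded[OF compact_continuous_image[OF cont compact_Icc[of "-t" t]]]
      unfolding bounded_iff by blast
    have M0: "0 \<le> M" using order_trans[OF norm_ge_zero M[of 0]] \<open>0 < t\<close> by simp
    have "cmod (F z) \<le> (cmod c * M * (2 * t)) * exp ((t + \<epsilon>) * cmod z)" for z
    proof -
      have "cmod (integral {-t..t} (\<lambda>u. exp (- \<i> * z * complex_of_real u) * \<phi> u)) \<le> (exp (t * cmod z) * M) * (t - (- t))"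
      proof (rule integral_bound)
        fix u assume u: "u \<in> {-t..t}"
        have "cmod (exp (- \<i> * z * complex_of_real u)) \<le> exp (cmod (- \<i> * z * complex_of_real u))"
          by (rule norm_exp)
        also have "\<dots> \<le> exp (t * cmod z)"
          using u by (auto simp: norm_mult mult.commute[of t] intro!: mult_left_mono)
        finally show "cmod (exp (- \<i> * z * complex_of_real u) * \<phi> u) \<le> exp (t * cmod z) * M"
          unfolding norm_mult by (intro mult_mono M u) auto
      qed (use \<open>0 < t\<close> in \<open>auto intro!: continuous_intros cont\<close>)
      then have "cmod (F z) \<le> cmod c * ((exp (t * cmod z) * M) * (t - (- t)))"
        unfolding F_def norm_mult by (rule mult_left_mono) simp
      also have "\<dots> = (cmod c * M * (2 * t)) * exp (t * cmod z)" by simp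
      also have "\<dots> \<le> (cmod c * M * (2 * t)) * exp ((t + \<epsilon>) * cmod z)"
        using \<open>0 < \<epsilon>\<close> \<open>0 < t\<close> M0 by (intro mult_left_mono) (auto simp: mult_right_mono)
      finally show ?thesis .
    qed
    then show "\<exists>C. \<forall>z. cmod (F z) \<le> C * exp ((t + \<epsilon>) * cmod z)" by blast
  qed
  moreover have "square_integrable (\<lambda>x. F (complex_of_real x))"
    using square_integrable_fourier_L1_C1[of "-t" t \<phi> \<phi>'] d continuous_on_subset[OF c'] \<open>0 < t\<close>
    unfolding F ind by simp
  ultimately have "F \<in> PW t" by (simp add: PW_def)
  then show ?thesis using F that by blast
qed

text \<open>The convolution theorem for \<phi> and the reflection of \<psi>. The reflection flips
  the sign of the frequency, so the second factor is an inverse transform, left without its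
  normalising constant.\<close>

lemma fourier_L1_correlation:
  assumes \<psi>: "integrable lborel \<psi>" and \<phi>: "integrable lborel \<phi>"
  shows "fourier_L1 (\<lambda>y. LINT x|lborel. \<psi> (x - y) * \<phi> x) \<xi>
    = fourier_L1 \<phi> \<xi> * (LINT u|lborel. exp (\<i> * complex_of_real (\<xi> * u)) * \<psi> u)"
proof -
  have [measurable]: "\<psi> \<in> borel_measurable borel" "\<phi> \<in> borel_measurable borel"
    using \<psi> \<phi> by auto
  have \<psi>x: "integrable lborel (\<lambda>y. \<psi> (x - y))" for x
    using lborel_integrable_real_affine[OF \<psi>, of "-1" x] by simp
  have norm_\<psi>: "(LINT y|lborel. cmod (\<psi> (x - y))) = (LINT u|lborel. cmod (\<psi> u))" for x
    using lborel_integral_real_affine[of "-1" "\<lambda>u. cmod (\<psi> u)" x] by simp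
  have e: "integrable lborel (\<lambda>y. exp (- \<i> * complex_of_real (\<xi> * y)) * \<psi> (x - y))" for x
    by (rule Bochner_Integration.integrable_bound[OF \<psi>x[of x]]) (auto simp: norm_mult)
  have prod: "integrable (lborel \<Otimes>\<^sub>M lborel) (\<lambda>(x, y). exp (- \<i> * complex_of_real (\<xi> * y)) * \<psi> (x - y) * \<phi> x)"
  proof (rule lborel_pair.Fubini_integrable)
    show "integrable lborel (\<lambda>x. LINT y|lborel. norm (case (x, y) of (x, y) \<Rightarrow> exp (- \<i> * complex_of_real (\<xi> * y)) * \<psi> (x - y) * \<phi> x))"
      using \<phi> by (simp add: norm_mult norm_\<psi>)
    show "AE x in lborel. integrable lborel (\<lambda>y. case (x, y) of (x, y) \<Rightarrow> exp (- \<i> * complex_of_real (\<xi> * y)) * \<psi> (x - y) * \<phi> x)"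
      using e by simp
  qed measurable
  have inner: "(LINT y|lborel. exp (- \<i> * complex_of_real (\<xi> * y)) * \<psi> (x - y))
      = exp (- \<i> * complex_of_real (\<xi> * x)) * (LINT u|lborel. exp (\<i> * complex_of_real (\<xi> * u)) * \<psi> u)" for x
  proof -
    have "(LINT y|lborel. exp (- \<i> * complex_of_real (\<xi> * y)) * \<psi> (x - y))
        = (LINT u|lborel. exp (- \<i> * complex_of_real (\<xi> * (x - u))) * \<psi> u)"
      using lborel_integral_real_affine[of "-1" "\<lambda>y. exp (- \<i> * complex_of_real (\<xi> * y)) * \<psi> (x - y)" x] by simp
    also have "\<dots> = (LINT u|lborel. exp (- \<i> * complex_of_real (\<xi> * x)) * (exp (\<i> * complex_of_real (\<xi> * u)) * \<psi> u))"
      by (intro Bochner_Integration.integral_cong) (auto simp: algebra_simps simp flip: exp_add)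
    finally show ?thesis by simp
  qed
  have "(LINT y|lborel. exp (- \<i> * complex_of_real (\<xi> * y)) * (LINT x|lborel. \<psi> (x - y) * \<phi> x))
      = (LINT y|lborel. LINT x|lborel. exp (- \<i> * complex_of_real (\<xi> * y)) * \<psi> (x - y) * \<phi> x)"
    by (simp add: mult.assoc)
  also have "\<dots> = (LINT x|lborel. LINT y|lborel. exp (- \<i> * complex_of_real (\<xi> * y)) * \<psi> (x - y) * \<phi> x)"
    by (rule lborel_pair.Fubini_integral[OF prod])
  also have "\<dots> = (LINT x|lborel. (exp (- \<i> * complex_of_real (\<xi> * x)) * \<phi> x) * (LINT u|lborel. exp (\<i> * complex_of_real (\<xi> * u)) * \<psi> u))"
    by (intro Bochner_Integration.integral_cong refl)
       (simp only: integral_mult_left_zero inner, simp only: mult_ac)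
  finally show ?thesis by (simp add: fourier_L1_def)
qed

theorem mainTheorem13:
  fixes \<mu> :: "real measure" and t :: real
    and k :: "complex \<Rightarrow> complex" and \<psi> :: "real \<Rightarrow> complex"
  assumes "PW_sampling \<mu>" and "t > 0"
    and "reproducing_kernel \<mu> t k"
    and "is_L2_fourier (\<lambda>x. k (complex_of_real x)) \<psi>"
  shows "(AE \<xi> in lborel. \<xi> \<notin> {-t..t} \<longrightarrow> \<psi> \<xi> = 0)
    \<and> (\<forall>\<phi>. test_fun_on \<phi> {-t<..<t} \<longrightarrow> conv_ft_measure_pair \<psi> \<mu> \<phi> = (LINT x|lborel. \<phi> x))
    \<and> k 0 = complex_of_real (1 / sqrt (2 * pi)) * (LINT \<xi>|lborel. \<psi> \<xi>)"
proof (intro conjI allI impI)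
  have k: "k \<in> PW t" and rep: "\<And>f. f \<in> PW t \<Longrightarrow> f 0 = (LINT x|\<mu>. f (complex_of_real x) * cnj (k (complex_of_real x)))"
    using assms(3) by (auto simp: reproducing_kernel_def)
  show supp: "AE \<xi> in lborel. \<xi> \<notin> {-t..t} \<longrightarrow> \<psi> \<xi> = 0"
    by (rule PW_fourier_support[OF k assms(2,4)])
  have \<psi>2: "square_integrable \<psi>" using assms(4) by (simp add: is_L2_fourier_def)
  then have [measurable]: "\<psi> \<in> borel_measurable borel" by (auto simp: square_integrable_def)
  \<comment> \<open>By \<open>supp\<close>, \<psi> agrees almost everywhere with its truncation to a
    bounded interval, where square integrability implies integrability.\<close>
  have \<psi>: "integrable lborel \<psi>"
    using square_integrable_integrable_on_interval[OF \<psi>2, of "-t" t]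
  proof (rule integrable_cong_AE_imp)
    show "AE u in lborel. indicator {-t..t} u *\<^sub>R \<psi> u = \<psi> u"
      using supp by eventually_elim (auto simp: indicator_def)
  qed simp
  have inv: "k (complex_of_real x) = complex_of_real (1 / sqrt (2 * pi)) * (LINT u|lborel. exp (\<i> * complex_of_real (x * u)) * \<psi> u)" for x
    by (rule PW_fourier_inversion[OF k assms(4) \<psi>])
  show "k 0 = complex_of_real (1 / sqrt (2 * pi)) * (LINT \<xi>|lborel. \<psi> \<xi>)"
    using inv[of 0] by simp
  fix \<phi> assume \<phi>: "test_fun_on \<phi> {-t<..<t}"
  obtain F where F: "F \<in> PW t" "\<And>x. F (complex_of_real x) = fourier_L1 \<phi> x"
    using test_fun_fourier_PW[OF assms(2) \<phi>] by blast
  have \<phi>i: "integrable lborel \<phi>"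
  proof -
    obtain \<phi>' where d: "\<And>u. (\<phi> has_vector_derivative \<phi>' u) (at u)"
      and ind: "(\<lambda>u. indicator {-t..t} u *\<^sub>R \<phi> u) = \<phi>"
      using test_fun_on_interval[OF \<phi>] by blast
    have "continuous_on {-t..t} \<phi>"
      using d by (intro continuous_on_vector_derivative) (auto intro: has_vector_derivative_at_within)
    from borel_integrable_atLeastAtMost'[OF this] show ?thesis
      by (simp add: set_integrable_def ind)
  qed
  \<comment> \<open>The constant by which the unnormalised integral in
    \<open>fourier_L1_correlation\<close> exceeds the value of \<open>k\<close> given by
    \<open>inv\<close>; it finally cancels against the normalisation in \<open>F 0\<close>.\<close>
  define q where "q = complex_of_real (sqrt (2 * pi))"
  have "fourier_L1 (\<lambda>y. LINT x|lborel. \<psi> (x - y) * \<phi> x) \<xi> = q * (F (complex_of_real \<xi>) * k (complex_of_real \<xi>))" for \<xi>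
    unfolding fourier_L1_correlation[OF \<psi> \<phi>i] F inv[of \<xi>] by (simp add: q_def)
  then have "conv_ft_measure_pair \<psi> \<mu> \<phi> = q * (LINT \<xi>|\<mu>. F (complex_of_real \<xi>) * k (complex_of_real \<xi>))"
    by (simp add: conv_ft_measure_pair_def)
  \<comment> \<open>The kernel enters the pairing without a conjugate, so it is reproduced against
    the reflected function \<open>cnj \<circ> F \<circ> cnj\<close>.\<close>
  also have "(LINT \<xi>|\<mu>. F (complex_of_real \<xi>) * k (complex_of_real \<xi>))
      = cnj (LINT \<xi>|\<mu>. cnj (F (complex_of_real \<xi>)) * cnj (k (complex_of_real \<xi>)))"
    by (simp flip: Bochner_Integration.integral_cnj)
  also have "\<dots> = F 0"
    using arg_cong[OF rep[OF PW_cnj[OF F(1)]], of cnj] by simp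
  also have "F 0 = complex_of_real (1 / sqrt (2 * pi)) * (LINT x|lborel. \<phi> x)"
    using F(2)[of 0] by (simp add: fourier_L1_def)
  finally show "conv_ft_measure_pair \<psi> \<mu> \<phi> = (LINT x|lborel. \<phi> x)"
    by (simp add: q_def)
qed

end
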